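(* Let $q>1$ and let $n\ge 0$ be an integer. Consider the following randomized procedure, with state consisting of an integer $m\ge 0$ and a partition $\lambda$. Step 0: Start with $m=n$ and $\lambda$ the empty partition. Step 1: If $m=0$ then stop and output $\lambda$. Otherwise choose an integer $a$ with $0\le a\le m$ with probability $$\frac{q^{m^2}\left(1-\frac{1}{q^{m-a+1}}\right)^2\cdots\left(1-\frac{1}{q^m}\right)^2}{q^{(m-a)^2+m}\,(\frac1q)_a}\cdot\frac{J_{m-a}(q)}{J_m(q)}.$$ Then increase $\lambda$ to $\Lambda$ with probability $$\left(1-\frac1q\right)\cdots\left(1-\frac1{q^a}\right)\frac{q^{n(\lambda)}\prod_{s\in\lambda}\left(1-\frac{1}{q^{h(s)}}\right)}{q^{n(\Lambda)}\prod_{s\in\Lambda}\left(1-\frac1{q^{h(s)}}\right)}$$ if $\Lambda-\lambda$ is a horizontal strip of size $a$, and with probability $0$ otherwise. Finally replace $m$ by $m-a$ and repeat Step 1. Then the output of this procedure is a random partition of $n$ whose distribution is the probability measure $M_{Pl,q}$ conditioned on the event $|\lambda|=n$.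
   Context: For a partition $\lambda$ with parts $\lambda_1\ge\lambda_2\ge\cdots\ge0$, $|\lambda|$ is the sum of its parts and $n(\lambda)=\sum_{i\ge1}(i-1)\lambda_i$ (not to be confused with the integer $n$). For a box $s$ of the diagram of a partition, $h(s)$ is its hook length in that partition (in $\prod_{s\in\lambda}$ hook lengths are taken in $\lambda$; in $\prod_{s\in\Lambda}$ they are taken in $\Lambda$). Empty products equal $1$. For partitions $\lambda\subseteq\Lambda$, the skew diagram $\Lambda-\lambda$ is the set-theoretic difference of the diagrams; it is a horizontal strip if it has at most one box in each column, and its size is its number of boxes. Write $(\frac1q)_i=(1-\frac1q)\cdots(1-\frac1{q^i})$, $(\frac1q)_0=1$. For an integer $a\ge0$, $J_a(q)$ is determined by $$\sum_{(n_1,n_2,\ldots):\ \sum_i n_i=a}\frac{1}{q^{\sum_i i n_i}\prod_i(\frac1q)_{n_i}}=\frac{J_a(q)}{q^{a^2}\left(1-\frac1q\right)^2\cdots\left(1-\frac1{q^a}\right)^2},$$ where the sum is over sequences of non-negative integers with sum $a$ (so $J_0(q)=1$). $M_{Pl,q}$ is the probability measure on the set of all partitions of all natural numbers (including the empty partition) given by $$M_{Pl,q}(\lambda)=\left[\prod_{r=1}^\infty\prod_{j=r}^\infty\left(1-\frac1{q^j}\right)\right]\frac{1}{q^{|\lambda|+2n(\lambda)}\prod_{s\in\lambda}\left(1-\frac{1}{q^{h(s)}}\right)^2};$$ equivalently, $M_{Pl,q}(\lambda)=s_\lambda(x)s_\lambda(y)\prod_{i,j}(1-x_iy_j)$ where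 $s_\lambda$ is the Schur function, $x_i=q^{-i}$ and $y_i=q^{-(i-1)}$ for $i\ge1$. *)

theory Defs
  imports "HOL-Probability.Probability"
begin

text \<open>
  Partitions are infinite, eventually zero, weakly decreasing sequences. Rows, columns and part
  indices are counted from 0, so \<open>part l i\<close> is $\lambda_{i+1}$.
\<close>

typedef partition = "{f :: nat \<Rightarrow> nat. antimono f \<and> finite {i. f i \<noteq> 0}}"
  morphisms part Abs_partition
  by (rule exI[of _ "\<lambda>_. 0"]) (simp add: antimono_def)

definition empty_partition :: partition where
  "empty_partition = Abs_partition (\<lambda>_. 0)"

definition psize :: "partition \<Rightarrow> nat" where
  "psize l = (\<Sum>i | part l i \<noteq> 0. part l i)"

text \<open>This is $n(\lambda)$; because rows are counted from 0, the factor $i-1$ becomes \<open>i\<close>.\<close>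

definition n_stat :: "partition \<Rightarrow> nat" where
  "n_stat l = (\<Sum>i | part l i \<noteq> 0. i * part l i)"

definition diagram :: "partition \<Rightarrow> (nat \<times> nat) set" where
  "diagram l = {(i, j). j < part l i}"

definition hook :: "partition \<Rightarrow> nat \<times> nat \<Rightarrow> nat" where
  "hook l s = card {j. snd s < j \<and> (fst s, j) \<in> diagram l}
            + card {i. fst s < i \<and> (i, snd s) \<in> diagram l} + 1"

definition horizontal_strip :: "partition \<Rightarrow> partition \<Rightarrow> bool" where
  "horizontal_strip l L \<longleftrightarrow>
     diagram l \<subseteq> diagram L \<and> (\<forall>j. card {i. (i, j) \<in> diagram L - diagram l} \<le> 1)"

text \<open>\<open>qfac q i\<close> is $(\frac1q)_i$.\<close>

definition qfac :: "real \<Rightarrow> nat \<Rightarrow> real" where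
  "qfac q i = (\<Prod>j=1..i. 1 - 1 / q ^ j)"

definition hook_prod :: "real \<Rightarrow> partition \<Rightarrow> real" where
  "hook_prod q l = (\<Prod>s\<in>diagram l. 1 - 1 / q ^ hook l s)"

text \<open>\<open>f i\<close> stands for $n_{i+1}$.\<close>

definition sequences_of_sum :: "nat \<Rightarrow> (nat \<Rightarrow> nat) set" where
  "sequences_of_sum a = {f. finite {i. f i \<noteq> 0} \<and> (\<Sum>i | f i \<noteq> 0. f i) = a}"

text \<open>The defining equation of $J_a(q)$, solved for $J_a(q)$.\<close>

definition J :: "nat \<Rightarrow> real \<Rightarrow> real" where
  "J a q = (q ^ (a\<^sup>2) * (\<Prod>i=1..a. (1 - 1 / q ^ i)\<^sup>2)) *
     (\<Sum>\<^sub>\<infinity>f\<in>sequences_of_sum a.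
        1 / (q ^ (\<Sum>i | f i \<noteq> 0. (i + 1) * f i) * (\<Prod>i | f i \<noteq> 0. qfac q (f i))))"

text \<open>The double product runs over $1 \le r' \le j'$ with $r' = r + 1$ and $j' = r' + j$.\<close>

definition Pl_weight :: "real \<Rightarrow> partition \<Rightarrow> real" where
  "Pl_weight q l = (\<Prod>r. \<Prod>j. 1 - 1 / q ^ (r + 1 + j)) *
     (1 / (q ^ (psize l + 2 * n_stat l) * (\<Prod>s\<in>diagram l. (1 - 1 / q ^ hook l s)\<^sup>2)))"

definition M_Pl :: "real \<Rightarrow> partition measure" where
  "M_Pl q = point_measure UNIV (\<lambda>l. ennreal (Pl_weight q l))"

definition size_prob :: "real \<Rightarrow> nat \<Rightarrow> nat \<Rightarrow> real" where
  "size_prob q m a =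
     (if a \<le> m then
        q ^ (m\<^sup>2) * (\<Prod>i=m-a+1..m. (1 - 1 / q ^ i)\<^sup>2) / (q ^ ((m - a)\<^sup>2 + m) * qfac q a)
          * (J (m - a) q / J m q)
      else 0)"

definition growth_prob :: "real \<Rightarrow> partition \<Rightarrow> nat \<Rightarrow> partition \<Rightarrow> real" where
  "growth_prob q l a L =
     (if horizontal_strip l L \<and> card (diagram L - diagram l) = a then
        (\<Prod>i=1..a. 1 - 1 / q ^ i) *
        ((q ^ n_stat l * hook_prod q l) / (q ^ n_stat L * hook_prod q L))
      else 0)"

text \<open>
  \<^const>\<open>embed_pmf\<close> only yields a distribution with the given point masses if these are
  non-negative and sum to 1; a statement about the procedure should therefore also assert that
  the point masses of the two distributions below are the intended ones.
\<close>

definition size_pmf :: "real \<Rightarrow> nat \<Rightarrow> nat pmf" where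
  "size_pmf q m = embed_pmf (size_prob q m)"

definition growth_pmf :: "real \<Rightarrow> partition \<Rightarrow> nat \<Rightarrow> partition pmf" where
  "growth_pmf q l a = embed_pmf (growth_prob q l a)"

text \<open>
  The step \<open>a = 0\<close> has positive probability and leaves the state unchanged, so there are
  infinite runs. The procedure is the least fixed point in the subprobability monad: the mass of
  \<open>l\<close> is the probability that the procedure stops with output \<open>l\<close>, and the missing mass is
  the probability that it never stops.
\<close>

partial_function (spmf) run :: "real \<Rightarrow> nat \<Rightarrow> partition \<Rightarrow> partition spmf" where
  "run q m l =
     (if m = 0 then return_spmf l
      else bind_pmf (size_pmf q m) (\<lambda>a.
             bind_pmf (growth_pmf q l a) (\<lambda>L. run q (m - a) L)))"

definition procedure_output :: "real \<Rightarrow> nat \<Rightarrow> partition spmf" where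
  "procedure_output q n = run q n empty_partition"

end

theory Submission
  imports Defs "Jordan_Normal_Form.Determinant"
begin

text \<open>
  Put $t = 1/q$ and let $S(\lambda) = t^{n(\lambda)} / \prod_s (1 - t^{h(s)})$, the value of
  $s_\lambda$ at $1, t, t^2, \dots$. Multiplying the probability of going from $(m, \lambda)$ to an
  output $\Lambda$ by $S(\lambda) / S(\Lambda)$ and by the left-hand side of the equation defining
  $J_m$ turns every transition probability into a power of $t$; what remains behaves like the skew Schur function
  $s_{\Lambda/\lambda}(t, t^2, \dots)$. So three facts about Schur functions are needed, and each of
  them has a finite, row by row proof. The branching rule
  $S(\Lambda) = \sum_\mu t^{|\mu|} S(\mu)$ over horizontal strips $\Lambda - \mu$ is a statement about
  sums of Vandermonde determinants over boxes. Pieri's rule, which says that the growth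
  probabilities sum to one, follows from the branching rule and the skew Cauchy identity in one
  variable. Symmetry of skew Schur functions, given by the Bender-Knuth involution, exchanges strips
  added first for strips added last and identifies the probability of going from $\emptyset$ to
  $\Lambda$ with a multiple of $S(\Lambda)^2$.
\<close>

subsection \<open>Determinants\<close>

text \<open>Empty strips are allowed, so every recursion here contains its own left-hand side,
  multiplied by some t^d with d > 0. Since t^d < 1, that term can be moved over and divided out, and
  the rest is induction on a size. This one device yields termination with probability one, Pieri's
  rule, the exchange of strips and the final formula. The exchange is forced by the form of the
  process: its recursion moves the starting partition, so a run from the empty partition leads to
  all other starting points, while the branching rule moves the final partition. After the exchange
  the start stays empty. Infinitely many variables never occur: multiplying t, t^2, ... by t drops
  the first variable, and homogeneity turns this into a factor t^(|L| - |l|). The infinite product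
  in \<open>M_Pl\<close> cancels under conditioning, so only its positivity matters. The weight of
  all partitions of n is read off from termination instead of a Cauchy identity.\<close>

definition qpoch :: "real \<Rightarrow> nat \<Rightarrow> real" where
  "qpoch t m = (\<Prod>i=1..m. 1 - t ^ i)"

lemma qpoch_0 [simp]: "qpoch t 0 = 1"
  by (simp add: qpoch_def)

lemma qpoch_Suc: "qpoch t (Suc m) = qpoch t m * (1 - t ^ Suc m)"
  by (simp add: qpoch_def)

lemma qpoch_pos: "0 < t \<Longrightarrow> t < 1 \<Longrightarrow> qpoch t m > 0"
  unfolding qpoch_def by (intro prod_pos) (auto simp: power_less_one_iff)

lemma qfac_eq_qpoch: "qfac q m = qpoch (1 / q) m"
  by (simp add: qfac_def qpoch_def power_one_over)

text \<open>Entries form a total function, so they can be rewritten by \<open>fun_det_cong\<close>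
  without carrier conditions.\<close>

definition fun_det :: "nat \<Rightarrow> (nat \<Rightarrow> nat \<Rightarrow> real) \<Rightarrow> real" where
  "fun_det k f = Determinant.det (Matrix.mat k k (\<lambda>(i, j). f i j))"

lemma fun_det_cong: "(\<And>i j. i < k \<Longrightarrow> j < k \<Longrightarrow> f i j = g i j) \<Longrightarrow> fun_det k f = fun_det k g"
  unfolding fun_det_def by (rule arg_cong[where f = Determinant.det]) (auto intro!: eq_matI)

lemma fun_det_Leibniz:
  "fun_det k f = (\<Sum>p | p permutes {0..<k}. signof p * (\<Prod>i=0..<k. f i (p i)))"
proof -
  have "fun_det k f = (\<Sum>p | p permutes {0..<k}. signof p *
          (\<Prod>i=0..<k. Matrix.mat k k (\<lambda>(i, j). f i j) $$ (i, p i)))"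
    unfolding fun_det_def by (rule det_def') simp
  also have "\<dots> = (\<Sum>p | p permutes {0..<k}. signof p * (\<Prod>i=0..<k. f i (p i)))"
  proof (intro sum.cong refl arg_cong2[where f = "(*)"] prod.cong)
    fix p i assume "p \<in> {p. p permutes {0..<k}}" "i \<in> {0..<k}"
    then have "p i \<in> {0..<k}"
      by (metis mem_Collect_eq permutes_in_image)
    with \<open>i \<in> {0..<k}\<close> show "Matrix.mat k k (\<lambda>(i, j). f i j) $$ (i, p i) = f i (p i)"
      by simp
  qed
  finally show ?thesis .
qed

lemma fun_det_mult: "fun_det k (\<lambda>i j. \<Sum>r<k. f i r * g r j) = fun_det k f * fun_det k g"
proof -
  have "Matrix.mat k k (\<lambda>(i, j). \<Sum>r<k. f i r * g r j)
      = Matrix.mat k k (\<lambda>(i, j). f i j) * Matrix.mat k k (\<lambda>(i, j). g i j)"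
    by (rule eq_matI) (auto simp: scalar_prod_def lessThan_atLeast0)
  then show ?thesis
    unfolding fun_det_def by (metis det_mult mat_carrier)
qed

lemma prod_list_diag_mat:
  "prod_list (diag_mat (Matrix.mat k k (\<lambda>(i, j). f i j))) = (\<Prod>i<k. f i i :: real)"
  by (simp add: prod_list_diag_prod lessThan_atLeast0)

lemma fun_det_upper:
  assumes "\<And>i j. j < i \<Longrightarrow> i < k \<Longrightarrow> f i j = 0"
  shows "fun_det k f = (\<Prod>i<k. f i i)"
  unfolding fun_det_def prod_list_diag_mat[symmetric]
  by (rule det_upper_triangular[where n = k]) (auto simp: assms)

lemma fun_det_lower:
  assumes "\<And>i j. i < j \<Longrightarrow> j < k \<Longrightarrow> f i j = 0"
  shows "fun_det k f = (\<Prod>i<k. f i i)"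
  unfolding fun_det_def prod_list_diag_mat[symmetric]
  by (rule det_lower_triangular[where n = k]) (auto simp: assms)

lemma fun_det_scale_rows: "fun_det k (\<lambda>i j. c i * f i j) = (\<Prod>i<k. c i) * fun_det k f"
proof -
  have "fun_det k (\<lambda>i j. c i * f i j) = fun_det k (\<lambda>i j. \<Sum>r<k. (if i = r then c i else 0) * f r j)"
    by (rule fun_det_cong) (simp add: if_distrib[of "\<lambda>x. x * _"] cong: if_cong)
  also have "\<dots> = (\<Prod>i<k. c i) * fun_det k f"
    by (simp add: fun_det_mult fun_det_upper)
  finally show ?thesis .
qed

abbreviation vdm :: "nat \<Rightarrow> (nat \<Rightarrow> real) \<Rightarrow> real" where
  "vdm k z \<equiv> fun_det k (\<lambda>i j. z i ^ j)"

text \<open>Replace x^j by the monic polynomial of degree j vanishing at z_0, ..., z_(j-1). Its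
  values at the z_i form a lower triangular matrix with the required diagonal, and the change of
  basis is unitriangular.\<close>

lemma vandermonde: "vdm k z = (\<Prod>j<k. \<Prod>i<j. z j - z i)"
proof -
  define p where "p j = (\<Prod>r<j. [:- z r, 1:])" for j :: nat
  have deg: "degree (p j) = j \<and> lead_coeff (p j) = 1" for j
  proof (induction j)
    case (Suc j)
    then have "p j \<noteq> 0" by auto
    then have "degree (p j * [:- z j, 1:]) = Suc j"
      using Suc by (subst degree_mult_eq) auto
    moreover have "lead_coeff (p j * [:- z j, 1:]) = 1"
      by (subst lead_coeff_mult) (use Suc in auto)
    ultimately show ?case
      by (auto simp: p_def)
  qed (simp add: p_def)
  have eval: "poly (p j) x = (\<Prod>r<j. x - z r)" for j x
    by (simp add: p_def poly_prod)
  have "(\<Prod>j<k. \<Prod>i<j. z j - z i) = fun_det k (\<lambda>i j. \<Prod>r<j. z i - z r)"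
    by (subst fun_det_lower) (auto simp: prod_zero_iff)
  also have "\<dots> = fun_det k (\<lambda>i j. \<Sum>r<k. z i ^ r * coeff (p j) r)"
  proof (rule fun_det_cong)
    fix i j assume "j < k"
    have "(\<Prod>r<j. z i - z r) = (\<Sum>r\<le>j. coeff (p j) r * z i ^ r)"
      using deg[of j] by (simp add: eval[symmetric] poly_altdef)
    also have "\<dots> = (\<Sum>r<k. z i ^ r * coeff (p j) r)"
      using \<open>j < k\<close> deg[of j]
      by (intro sum.mono_neutral_cong_left) (auto simp: mult.commute coeff_eq_0)
    finally show "(\<Prod>r<j. z i - z r) = (\<Sum>r<k. z i ^ r * coeff (p j) r)" .
  qed
  also have "\<dots> = vdm k z * fun_det k (\<lambda>r j. coeff (p j) r)"
    by (rule fun_det_mult)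
  also have "fun_det k (\<lambda>r j. coeff (p j) r) = (\<Prod>j<k. coeff (p j) j)"
    by (rule fun_det_upper) (use deg in \<open>simp add: coeff_eq_0\<close>)
  also have "\<dots> = 1"
    using deg by (intro prod.neutral) (metis)
  finally show ?thesis by simp
qed

section \<open>Sums of Vandermonde determinants over boxes\<close>

lemma qpoch_partial_sum:
  assumes "0 < t" "t < 1"
  shows "(\<Sum>m\<le>n. t ^ m / qpoch t m) = 1 / qpoch t n"
proof (induction n)
  case (Suc n)
  define w where "w = t ^ Suc n"
  have "qpoch t n \<noteq> 0" "1 - w \<noteq> 0"
    using qpoch_pos[OF assms, of n] assms power_less_one_iff[of t "Suc n"] by (auto simp: w_def)
  then show ?case
    unfolding sum.atMost_Suc Suc.IH qpoch_Suc w_def[symmetric] by (simp add: field_simps)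
qed simp

text \<open>Write t^m = 1 - (1 - t^m). Since (1 - t^m) / qpoch t m = 1 / qpoch t (m - 1), the second
  part is t^(j+1) times the sum with exponent j+1, short of its last term.\<close>

lemma qpoch_partial_sum_rec:
  assumes "0 < t" "t < 1"
  shows "(\<Sum>m\<le>n. t ^ (m * Suc (Suc j)) / qpoch t m)
       = t ^ Suc j * (t ^ (n * Suc j) / qpoch t n)
         + (1 - t ^ Suc j) * (\<Sum>m\<le>n. t ^ (m * Suc j) / qpoch t m)"
proof (induction n)
  case (Suc n)
  define x where "x = t ^ Suc j"
  define y where "y = t ^ (n * Suc j)"
  define w where "w = t ^ Suc n"
  have nz: "qpoch t n \<noteq> 0" "1 - w \<noteq> 0"
    using qpoch_pos[OF assms, of n] assms power_less_one_iff[of t "Suc n"] by (auto simp: w_def)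
  then have y_Q: "y / qpoch t n = y * (1 - w) / (qpoch t n * (1 - w))"
    by simp
  have e: "t ^ (Suc n * Suc j) = y * x" "t ^ (Suc n * Suc (Suc j)) = y * x * w"
    unfolding x_def y_def w_def power_add[symmetric] by (auto simp: algebra_simps)
  show ?case
    unfolding sum.atMost_Suc Suc.IH e qpoch_Suc w_def[symmetric] x_def[symmetric] y_def[symmetric]
      y_Q
    by (simp add: diff_divide_distrib algebra_simps)
qed simp

text \<open>Multilinearity: row i depends on \<open>m i\<close> alone, so in each Leibniz term the
  sum over the box factors into one sum per row.\<close>

lemma sum_box_alternant:
  assumes "\<And>i. i < k \<Longrightarrow> finite (M i)"
  shows "(\<Sum>m\<in>(\<Pi>\<^sub>E i\<in>{0..<k}. M i). fun_det k (\<lambda>i j. f (m i) j))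
       = fun_det k (\<lambda>i j. \<Sum>x\<in>M i. f x j :: real)"
proof -
  have "(\<Sum>m\<in>(\<Pi>\<^sub>E i\<in>{0..<k}. M i). fun_det k (\<lambda>i j. f (m i) j))
     = (\<Sum>p | p permutes {0..<k}. signof p *
          (\<Sum>m\<in>(\<Pi>\<^sub>E i\<in>{0..<k}. M i). \<Prod>i=0..<k. f (m i) (p i)))"
    unfolding fun_det_Leibniz by (subst sum.swap) (simp add: sum_distrib_left)
  also have "\<dots> = fun_det k (\<lambda>i j. \<Sum>x\<in>M i. f x j)"
    unfolding fun_det_Leibniz
    by (subst prod_sum_PiE) (use assms in auto)
  finally show ?thesis .
qed

text \<open>Column j holds the coefficients of the polynomial P_j of degree j for which the sum of
  t^(m(j+1)) / qpoch t m over m up to n is P_j(t^n) / qpoch t n. Only the leading coefficients t^j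
  survive in the determinant.\<close>

primrec tri_coeff :: "real \<Rightarrow> nat \<Rightarrow> nat \<Rightarrow> real" where
  "tri_coeff t r 0 = (if r = 0 then 1 else 0)"
| "tri_coeff t r (Suc j) = (if r = Suc j then t ^ Suc j else 0) + (1 - t ^ Suc j) * tri_coeff t r j"

lemma tri_coeff_eq_0: "j < r \<Longrightarrow> tri_coeff t r j = 0"
  by (induction j) auto

lemma tri_coeff_diag: "tri_coeff t r r = t ^ r"
  by (cases r) (auto simp: tri_coeff_eq_0)

lemma qpoch_partial_sum_tri:
  assumes "0 < t" "t < 1"
  shows "j < k \<Longrightarrow> (\<Sum>m\<le>n. t ^ (m * Suc j) / qpoch t m)
       = (\<Sum>r<k. (t ^ (n * r) / qpoch t n) * tri_coeff t r j)"
proof (induction j)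
  case 0
  then show ?case
    using qpoch_partial_sum[OF assms, of n]
    by (simp add: if_distrib[of "\<lambda>x. _ * x"] cong: if_cong)
next
  case (Suc j)
  then show ?case
    unfolding qpoch_partial_sum_rec[OF assms] tri_coeff.simps distrib_left sum.distrib
    by (simp add: if_distrib[of "\<lambda>x. _ * x"] sum_distrib_left mult_ac cong: if_cong)
qed

text \<open>The branching rule in strictly decreasing coordinates. Row i sums over an interval,
  hence is a difference of two partial sums, and subtracting neighbouring rows is multiplication by
  a unitriangular matrix. The partial sums themselves factor as a row-scaled Vandermonde matrix
  times \<open>tri_coeff\<close>.\<close>

lemma interlacing_vandermonde_sum:
  fixes l :: "nat \<Rightarrow> nat"
  assumes t: "0 < t" "t < 1" and l: "\<And>i. Suc i < k \<Longrightarrow> l (Suc i) < l i"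
  shows "(\<Sum>m\<in>(\<Pi>\<^sub>E i\<in>{0..<k}. {(if Suc i < k then Suc (l (Suc i)) else 0)..l i}).
            (\<Prod>i<k. t ^ m i / qpoch t (m i)) * vdm k (\<lambda>i. t ^ m i))
       = (\<Prod>j<k. t ^ j) * (vdm k (\<lambda>i. t ^ l i) / (\<Prod>i<k. qpoch t (l i)))"
    (is "?L = ?R")
proof -
  define A where "A j n = (\<Sum>m\<le>n. t ^ (m * Suc j) / qpoch t m)" for j n
  \<comment> \<open>The factor belonging to \<open>m i\<close> is absorbed into row i, where t^(m i)
    raises the exponent j to j+1.\<close>
  have "?L = fun_det k (\<lambda>i j. \<Sum>x\<in>{(if Suc i < k then Suc (l (Suc i)) else 0)..l i}.
               t ^ (x * Suc j) / qpoch t x)"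
    by (subst sum_box_alternant[symmetric], simp)
       (auto simp: fun_det_scale_rows[symmetric] power_add simp flip: power_mult intro!: sum.cong fun_det_cong)
  also have "\<dots> = fun_det k (\<lambda>i j. \<Sum>r<k.
               (if r = i then 1 else if r = Suc i then - 1 else 0) * A j (l r))"
  proof (rule fun_det_cong)
    fix i j assume i: "i < k"
    let ?f = "\<lambda>x. t ^ (x * Suc j) / qpoch t x"
    have "(\<Sum>r<k. (if r = i then 1 else if r = Suc i then - 1 else 0) * A j (l r))
        = (\<Sum>r<k. (if r = i then A j (l i) else 0) + (if r = Suc i then - A j (l (Suc i)) else 0))"
      by (intro sum.cong) auto
    also have "\<dots> = A j (l i) - (if Suc i < k then A j (l (Suc i)) else 0)"
      using i by (simp add: sum.distrib)
    also have "\<dots> = (\<Sum>x\<in>{(if Suc i < k then Suc (l (Suc i)) else 0)..l i}. ?f x)"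
    proof (cases "Suc i < k")
      case True
      have "{..l i} = {..l (Suc i)} \<union> {Suc (l (Suc i))..l i}"
        using l[OF True] by auto
      then have "A j (l i) = A j (l (Suc i)) + (\<Sum>x\<in>{Suc (l (Suc i))..l i}. ?f x)"
        unfolding A_def by (simp add: sum.union_disjoint)
      with True show ?thesis by simp
    qed (simp add: A_def atLeast0AtMost)
    finally show "(\<Sum>x\<in>{(if Suc i < k then Suc (l (Suc i)) else 0)..l i}. ?f x) =
        (\<Sum>r<k. (if r = i then 1 else if r = Suc i then - 1 else 0) * A j (l r))"
      by simp
  qed
  also have "\<dots> = fun_det k (\<lambda>i j. A j (l i))"
    by (subst fun_det_mult, subst fun_det_upper) auto
  also have "\<dots> = fun_det k (\<lambda>i j. \<Sum>r<k. (1 / qpoch t (l i) * (t ^ l i) ^ r) * tri_coeff t r j)"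
    by (rule fun_det_cong) (subst A_def, subst qpoch_partial_sum_tri[OF t], assumption, simp flip: power_mult)
  also have "\<dots> = ?R"
    unfolding fun_det_mult fun_det_scale_rows
    by (subst (2) fun_det_upper) (auto simp: tri_coeff_eq_0 tri_coeff_diag prod_dividef)
  finally show ?thesis .
qed

subsection \<open>Partitions and interlacing\<close>

lemma finite_part_support [simp]: "finite {i. part l i \<noteq> 0}"
  using part[of l] by auto

lemma part_antimono: "i \<le> j \<Longrightarrow> part l j \<le> part l i"
  using part[of l] by (auto simp: antimono_def)

lemma partition_eqI: "(\<And>i. part l i = part m i) \<Longrightarrow> l = m"
  using part_inject by blast

lemma part_eventually_0: "\<exists>k. part l k = 0"
proof -
  from finite_part_support[of l] obtain k where "\<forall>i\<in>{i. part l i \<noteq> 0}. i < k"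
    using finite_nat_set_iff_bounded by blast
  then show ?thesis by auto
qed

lemma part_0_mono: "part l k = 0 \<Longrightarrow> k \<le> i \<Longrightarrow> part l i = 0"
  using part_antimono[of k i l] by simp

lemma part_empty_partition [simp]: "part empty_partition i = 0"
  unfolding empty_partition_def by (subst Abs_partition_inverse) (auto simp: antimono_def)

lemma finite_support_imp_sum:
  fixes k :: nat
  assumes "part l k = 0"
  shows "(\<Sum>i | part l i \<noteq> 0. g i * part l i) = (\<Sum>i<k. g i * part l i)"
proof (rule sum.mono_neutral_left)
  show "{i. part l i \<noteq> 0} \<subseteq> {..<k}"
  proof
    fix i assume "i \<in> {i. part l i \<noteq> 0}"
    then show "i \<in> {..<k}"
      using part_0_mono[OF assms, of i] by (cases "k \<le> i") auto
  qed
qed auto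

lemma psize_eq_sum:
  assumes "part l k = 0"
  shows "psize l = (\<Sum>i<k. part l i)"
  using finite_support_imp_sum[OF assms, where g = "\<lambda>_. 1"] by (simp add: psize_def)

lemma n_stat_eq_sum:
  assumes "part l k = 0"
  shows "n_stat l = (\<Sum>i<k. i * part l i)"
  using finite_support_imp_sum[OF assms] by (simp add: n_stat_def)

text \<open>The rowwise form of \<open>horizontal_strip\<close>, smaller partition first. For fixed
  \<open>l\<close> each row of \<open>m\<close> has its own interval, and any choice from these
  intervals is a partition.\<close>

definition interlace :: "partition \<Rightarrow> partition \<Rightarrow> bool" where
  "interlace m l \<longleftrightarrow> (\<forall>i. part m i \<le> part l i \<and> part l (Suc i) \<le> part m i)"

lemma interlace_refl [simp]: "interlace l l"
  by (simp add: interlace_def part_antimono)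

lemma interlaceD:
  "interlace m l \<Longrightarrow> part m i \<le> part l i" "interlace m l \<Longrightarrow> part l (Suc i) \<le> part m i"
  by (auto simp: interlace_def)

lemma part_le_imp_psize_le:
  assumes "\<And>i. part m i \<le> part l i"
  shows "psize m \<le> psize l" "psize m = psize l \<Longrightarrow> m = l"
proof -
  obtain k where k: "part l k = 0"
    using part_eventually_0 by blast
  then have k': "part m k = 0"
    using assms by (metis le_zero_eq)
  show "psize m \<le> psize l"
    unfolding psize_eq_sum[OF k] psize_eq_sum[OF k'] by (intro sum_mono assms)
  assume "psize m = psize l"
  then have eq: "(\<Sum>i<k. part m i) = (\<Sum>i<k. part l i)"
    unfolding psize_eq_sum[OF k] psize_eq_sum[OF k'] by simp
  have "part m i = part l i" for i
  proof (cases "i < k")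
    case True
    then show ?thesis
      using sum_mono_inv[OF eq assms] by simp
  qed (simp add: part_0_mono[OF k] part_0_mono[OF k'])
  then show "m = l" by (rule partition_eqI)
qed

lemma interlace_psize_le: "interlace m l \<Longrightarrow> psize m \<le> psize l"
  and interlace_psize_eq: "interlace m l \<Longrightarrow> psize m = psize l \<Longrightarrow> m = l"
  using part_le_imp_psize_le interlaceD by blast+

lemma finite_partitions_size_le: "finite {l. psize l \<le> n}"
proof -
  have "part ` {l. psize l \<le> n} \<subseteq> {f. \<forall>i. (i \<in> {..<n} \<longrightarrow> f i \<in> {..n}) \<and> (i \<notin> {..<n} \<longrightarrow> f i = 0)}"
  proof (clarify, intro conjI allI impI)
    fix l i assume l: "psize l \<le> n"
    obtain k where k: "part l k = 0"
      using part_eventually_0 by blast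
    have "part l i \<le> psize l" for i
      unfolding psize_eq_sum[OF k]
      by (cases "i < k") (auto simp: part_0_mono[OF k] intro!: member_le_sum)
    then show "part l i \<in> {..n}" using l le_trans by blast
    assume "i \<notin> {..<n}"
    show "part l i = 0"
    proof (rule ccontr)
      assume ne: "part l i \<noteq> 0"
      have "i < k" using part_0_mono[OF k, of i] ne by (cases "i < k") auto
      have "Suc i = (\<Sum>j\<in>{..i}. 1)" by simp
      also have "\<dots> \<le> (\<Sum>j\<in>{..i}. part l j)"
      proof (rule sum_mono)
        fix j assume "j \<in> {..i}"
        then have "part l i \<le> part l j" by (simp add: part_antimono)
        then show "1 \<le> part l j" using ne by simp
      qed
      also have "\<dots> \<le> (\<Sum>j<k. part l j)"
        using \<open>i < k\<close> by (intro sum_mono2) auto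
      finally show False
        using l \<open>i \<notin> {..<n}\<close> by (simp add: psize_eq_sum[OF k])
    qed
  qed
  then have "finite (part ` {l. psize l \<le> n})"
    by (rule finite_subset) (rule finite_set_of_finite_funs, auto)
  then show ?thesis
    by (rule finite_imageD) (simp add: inj_on_def part_inject)
qed

lemma finite_partitions_size: "finite {l. psize l = n}"
  by (rule finite_subset[OF _ finite_partitions_size_le[of n]]) auto

lemma psize_empty [simp]: "psize empty_partition = 0"
  by (simp add: psize_def)

lemma psize_eq_0_iff: "psize l = 0 \<longleftrightarrow> l = empty_partition"
  using part_le_imp_psize_le(2)[of empty_partition l] by auto

subsection \<open>Diagrams\<close>

lemma diagram_eq_Sigma:
  assumes "part l k = 0"
  shows "diagram l = (SIGMA i:{..<k}. {..<part l i})"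
proof -
  have "i < k" if "j < part l i" for i j
    using part_0_mono[OF assms, of i] that by (cases "k \<le> i") auto
  then show ?thesis by (auto simp: diagram_def)
qed

lemma finite_diagram [simp]: "finite (diagram l)"
proof -
  obtain k where k: "part l k = 0"
    using part_eventually_0 by blast
  show ?thesis by (simp add: diagram_eq_Sigma[OF k])
qed

lemma card_diagram: "card (diagram l) = psize l"
proof -
  obtain k where k: "part l k = 0"
    using part_eventually_0 by blast
  show ?thesis by (simp add: diagram_eq_Sigma[OF k] psize_eq_sum[OF k])
qed

lemma diagram_subset_iff: "diagram l \<subseteq> diagram L \<longleftrightarrow> (\<forall>i. part l i \<le> part L i)"
proof
  assume sub: "diagram l \<subseteq> diagram L"
  show "\<forall>i. part l i \<le> part L i"
  proof
    fix i
    show "part l i \<le> part L i"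
    proof (rule ccontr)
      assume "\<not> part l i \<le> part L i"
      then have "(i, part L i) \<in> diagram l" by (simp add: diagram_def)
      with sub have "(i, part L i) \<in> diagram L" by blast
      then show False by (simp add: diagram_def)
    qed
  qed
next
  assume "\<forall>i. part l i \<le> part L i"
  then show "diagram l \<subseteq> diagram L"
    by (auto simp: diagram_def intro: less_le_trans)
qed

lemma finite_diagram_column: "finite {r. (r, j) \<in> diagram L \<and> P r}"
proof (rule finite_subset)
  show "{r. (r, j) \<in> diagram L \<and> P r} \<subseteq> fst ` diagram L"
    by (metis (mono_tags, lifting) fst_conv image_eqI mem_Collect_eq subsetI)
qed simp

lemma card_strip: "diagram l \<subseteq> diagram L \<Longrightarrow> card (diagram L - diagram l) = psize L - psize l"
  by (simp add: card_Diff_subset card_diagram)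

lemma horizontal_strip_iff_interlace: "horizontal_strip l L \<longleftrightarrow> interlace l L"
proof
  assume h: "horizontal_strip l L"
  then have "diagram l \<subseteq> diagram L" and col: "\<And>j. card {r. (r, j) \<in> diagram L - diagram l} \<le> 1"
    by (simp_all only: horizontal_strip_def)
  then have le: "part l i \<le> part L i" for i
    by (simp only: diagram_subset_iff)
  moreover have "part L (Suc i) \<le> part l i" for i
  proof (rule ccontr)
    assume "\<not> part L (Suc i) \<le> part l i"
    \<comment> \<open>If row i+1 of \<open>L\<close> extends beyond \<open>part l i\<close>, so does
      row i, and this column has two boxes outside \<open>l\<close>.\<close>
    then have "{i, Suc i} \<subseteq> {r. (r, part l i) \<in> diagram L - diagram l}"
      using part_antimono[of i "Suc i" l] part_antimono[of i "Suc i" L]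
      by (auto simp: diagram_def)
    moreover have "finite {r. (r, part l i) \<in> diagram L - diagram l}"
      by (simp add: finite_diagram_column)
    ultimately have "card {i, Suc i} \<le> card {r. (r, part l i) \<in> diagram L - diagram l}"
      by (intro card_mono)
    also have "\<dots> \<le> 1"
      by (rule col)
    finally show False by simp
  qed
  ultimately show "interlace l L"
    by (auto simp: interlace_def)
next
  assume i: "interlace l L"
  have "card {r. (r, j) \<in> diagram L - diagram l} \<le> 1" for j
  proof -
    have "r = s" if "(r, j) \<in> diagram L - diagram l" "(s, j) \<in> diagram L - diagram l" "r \<le> s" for r s
    proof (rule ccontr)
      assume "r \<noteq> s"
      with that have "part L s \<le> part L (Suc r)"
        by (intro part_antimono) auto
      also have "\<dots> \<le> part l r" by (rule interlaceD[OF i])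
      finally show False using that by (auto simp: diagram_def)
    qed
    then have "\<forall>r\<in>{r. (r, j) \<in> diagram L - diagram l}. \<forall>s\<in>{r. (r, j) \<in> diagram L - diagram l}. r = s"
      by (metis linorder_le_cases mem_Collect_eq)
    moreover have "finite {r. (r, j) \<in> diagram L - diagram l}"
      by (simp add: finite_diagram_column)
    ultimately show ?thesis
      by (simp only: One_nat_def card_le_Suc0_iff_eq)
  qed
  then show "horizontal_strip l L"
    unfolding horizontal_strip_def diagram_subset_iff using interlaceD[OF i] by blast
qed

subsection \<open>Hook lengths and the branching rule\<close>

text \<open>The parts of the conjugate partition.\<close>

definition col_len :: "partition \<Rightarrow> nat \<Rightarrow> nat" where
  "col_len l c = (LEAST r. part l r \<le> c)"

lemma less_col_len_iff: "r < col_len l c \<longleftrightarrow> c < part l r"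
proof -
  obtain k where "part l k = 0" using part_eventually_0 by blast
  then have *: "part l (col_len l c) \<le> c"
    using LeastI[where P = "\<lambda>r. part l r \<le> c" and k = k] by (simp add: col_len_def)
  show ?thesis
  proof
    assume "r < col_len l c"
    then show "c < part l r"
      unfolding col_len_def by (metis not_less_Least not_le)
  next
    assume "c < part l r"
    with * show "r < col_len l c"
      using part_antimono[of "col_len l c" r l] by (metis leD le_trans not_le)
  qed
qed

lemma hook_eq:
  assumes "c < part l i"
  shows "hook l (i, c) + c + i + 1 = part l i + col_len l c"
proof -
  have "i < col_len l c" using assms by (simp add: less_col_len_iff)
  moreover have "{j. c < j \<and> j < part l i} = {c<..<part l i}" by auto
  moreover have "{r. i < r \<and> c < part l r} = {i<..<col_len l c}"
    by (auto simp: less_col_len_iff)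
  ultimately show ?thesis
    using assms by (simp add: hook_def diagram_def)
qed

text \<open>The staircase k-1, ..., 0 is added to make the parts strictly decreasing; interlacing
  then becomes the box of \<open>interlacing_vandermonde_sum\<close>.\<close>

definition beta_number :: "nat \<Rightarrow> partition \<Rightarrow> nat \<Rightarrow> nat" where
  "beta_number k l i = part l i + (k - 1 - i)"

lemma beta_number_strict_antimono: "i < j \<Longrightarrow> j < k \<Longrightarrow> beta_number k l j < beta_number k l i"
  unfolding beta_number_def using part_antimono[of i j l] by linarith

text \<open>The hook lengths of row \<open>i\<close> together with the differences \<open>beta_number i - beta_number j\<close>, \<open>j > i\<close>,
  exhaust \<open>1, \<dots>, beta_number i\<close>.\<close>

lemma row_hook_product:
  assumes k: "part l k = 0" and i: "i < k"
  shows "(\<Prod>c<part l i. 1 - t ^ hook l (i, c)) * (\<Prod>j\<in>{i<..<k}. 1 - t ^ (beta_number k l i - beta_number k l j))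
       = qpoch t (beta_number k l i)"
proof -
  define h where "h c = hook l (i, c)" for c
  define d where "d j = beta_number k l i - beta_number k l j" for j
  let ?A = "h ` {..<part l i}" and ?B = "d ` {i<..<k}"
  have h: "h c + c + i + 1 = part l i + col_len l c" if "c < part l i" for c
    using hook_eq[OF that] by (simp add: h_def)
  have d: "d j + part l j = part l i + (j - i)" if "i < j" "j < k" for j
    using part_antimono[of i j l] that by (simp add: d_def beta_number_def)
  have col_mono: "col_len l c' \<le> col_len l c" if "c \<le> c'" for c c'
  proof -
    have "\<not> col_len l c < col_len l c'"
      using less_col_len_iff[of "col_len l c" l c] less_col_len_iff[of "col_len l c" l c'] that
      by auto
    then show ?thesis by simp
  qed
  have col_le: "col_len l c \<le> k" for c
    using less_col_len_iff[of k l c] k by simp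
  have injh: "inj_on h {..<part l i}"
  proof (rule linorder_inj_onI)
    fix c c' assume "c < c'" "c \<in> {..<part l i}" "c' \<in> {..<part l i}"
    then show "h c \<noteq> h c'"
      using h[of c] h[of c'] col_mono[of c c'] by auto
  qed auto
  have injd: "inj_on d {i<..<k}"
  proof (rule linorder_inj_onI)
    fix j j' assume "j < j'" "j \<in> {i<..<k}" "j' \<in> {i<..<k}"
    then show "d j \<noteq> d j'"
      using d[of j] d[of j'] part_antimono[of j j' l] by auto
  qed auto
  have disj: "?A \<inter> ?B = {}"
  proof -
    \<comment> \<open>The box (j, c) decides: if it lies in the diagram, column c reaches below row
      j and \<open>h c > d j\<close>; otherwise \<open>h c < d j\<close>.\<close>
    have "h c \<noteq> d j" if "c < part l i" "i < j" "j < k" for c j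
      using h[of c] d[of j] less_col_len_iff[of j l c] that
      by (cases "c < part l j") auto
    then show ?thesis by auto
  qed
  have sub: "?A \<union> ?B \<subseteq> {1..beta_number k l i}"
  proof -
    have "h c \<in> {1..beta_number k l i}" if "c < part l i" for c
      using h[OF that] less_col_len_iff[of i l c] col_le[of c] that i by (auto simp: beta_number_def)
    moreover have "d j \<in> {1..beta_number k l i}" if "i < j" "j < k" for j
      using beta_number_strict_antimono[OF that, of l] by (auto simp: d_def)
    ultimately show ?thesis by auto
  qed
  \<comment> \<open>There are \<open>part l i\<close> hooks and k - 1 - i differences, exactly as
    many as the interval has elements.\<close>
  have "card (?A \<union> ?B) = card {1..beta_number k l i}"
    using injh injd disj i by (simp add: card_Un_disjoint card_image beta_number_def)
  then have eq: "?A \<union> ?B = {1..beta_number k l i}"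
    using sub by (intro card_subset_eq) auto
  have "qpoch t (beta_number k l i) = (\<Prod>x\<in>?A. 1 - t ^ x) * (\<Prod>x\<in>?B. 1 - t ^ x)"
    unfolding qpoch_def eq[symmetric] using disj by (intro prod.union_disjoint) auto
  also have "\<dots> = (\<Prod>c<part l i. 1 - t ^ h c) * (\<Prod>j\<in>{i<..<k}. 1 - t ^ d j)"
    using injh injd by (simp add: prod.reindex)
  finally show ?thesis by (simp add: h_def d_def)
qed

definition schur :: "real \<Rightarrow> partition \<Rightarrow> real" where
  "schur t l = t ^ n_stat l / (\<Prod>s\<in>diagram l. 1 - t ^ hook l s)"

lemma hook_pos: "hook l s > 0"
  by (simp add: hook_def)

lemma schur_pos: "0 < t \<Longrightarrow> t < 1 \<Longrightarrow> schur t l > 0"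
  unfolding schur_def
  by (intro divide_pos_pos prod_pos) (auto simp: power_less_one_iff hook_pos)

lemma hook_product:
  assumes k: "part l k = 0"
  shows "(\<Prod>s\<in>diagram l. 1 - t ^ hook l s) * (\<Prod>j<k. \<Prod>i<j. 1 - t ^ (beta_number k l i - beta_number k l j))
       = (\<Prod>i<k. qpoch t (beta_number k l i))"
proof -
  have "(\<Prod>s\<in>diagram l. 1 - t ^ hook l s) = (\<Prod>i<k. \<Prod>c<part l i. 1 - t ^ hook l (i, c))"
    unfolding diagram_eq_Sigma[OF k] by (subst prod.Sigma) (auto simp: case_prod_unfold)
  moreover have "(\<Prod>j<k. \<Prod>i<j. 1 - t ^ (beta_number k l i - beta_number k l j))
       = (\<Prod>i<k. \<Prod>j\<in>{i<..<k}. 1 - t ^ (beta_number k l i - beta_number k l j))"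
    by (subst (1 2) prod.Sigma, simp_all) (rule prod.reindex_bij_witness[of _ prod.swap prod.swap], auto)
  ultimately show ?thesis
    by (simp add: prod.distrib[symmetric] row_hook_product[OF k])
qed

text \<open>Taking the smaller power out of each Vandermonde difference leaves the product of
  \<open>hook_product\<close> and t to the sum of j times the j-th beta-number. The parts contribute
  \<open>n_stat l\<close> to this exponent, the staircase the extra power on the left. Any
  sufficient number k of rows will do, so interlacing partitions can share it.\<close>

lemma schur_eq_vdm:
  assumes t: "0 < t" "t < 1" and k: "part l k = 0"
  shows "schur t l * t ^ (\<Sum>j<k. j * (k - 1 - j))
       = vdm k (\<lambda>i. t ^ beta_number k l i) / (\<Prod>i<k. qpoch t (beta_number k l i))"
proof -
  let ?P = "\<Prod>j<k. \<Prod>i<j. 1 - t ^ (beta_number k l i - beta_number k l j)"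
  let ?H = "\<Prod>s\<in>diagram l. 1 - t ^ hook l s"
  have H: "?H > 0"
    using t by (intro prod_pos) (auto simp: power_less_one_iff hook_pos)
  have Q: "(\<Prod>i<k. qpoch t (beta_number k l i)) > 0"
    using t by (intro prod_pos) (auto simp: qpoch_pos)
  have "vdm k (\<lambda>i. t ^ beta_number k l i) = (\<Prod>j<k. \<Prod>i<j. t ^ beta_number k l j * (1 - t ^ (beta_number k l i - beta_number k l j)))"
    unfolding vandermonde
  proof (intro prod.cong refl)
    fix i j assume "j \<in> {..<k}" "i \<in> {..<j}"
    then have "beta_number k l i = beta_number k l j + (beta_number k l i - beta_number k l j)"
      using beta_number_strict_antimono[of i j k l] by simp
    then have "t ^ beta_number k l i = t ^ beta_number k l j * t ^ (beta_number k l i - beta_number k l j)"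
      by (metis power_add)
    then show "t ^ beta_number k l j - t ^ beta_number k l i = t ^ beta_number k l j * (1 - t ^ (beta_number k l i - beta_number k l j))"
      by (simp add: right_diff_distrib)
  qed
  also have "\<dots> = (\<Prod>j<k. t ^ (j * beta_number k l j)) * ?P"
    by (simp add: prod.distrib power_mult[symmetric] mult.commute)
  also have "(\<Prod>j<k. t ^ (j * beta_number k l j)) = t ^ n_stat l * t ^ (\<Sum>j<k. j * (k - 1 - j))"
    unfolding power_sum[symmetric] n_stat_eq_sum[OF k] power_add[symmetric]
    by (simp only: beta_number_def distrib_left sum.distrib)
  finally have vdm: "vdm k (\<lambda>i. t ^ beta_number k l i) = t ^ n_stat l * t ^ (\<Sum>j<k. j * (k - 1 - j)) * ?P" .
  have HP: "?H * ?P = (\<Prod>i<k. qpoch t (beta_number k l i))"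
    by (rule hook_product[OF k])
  have "?P \<noteq> 0"
    using HP Q by (metis less_irrefl mult_zero_right)
  then show ?thesis
    unfolding vdm HP[symmetric] schur_def using H by simp
qed

lemma part_Abs_partition:
  assumes "\<And>i. f (Suc i) \<le> f i" "f k = 0"
  shows "part (Abs_partition f) = f"
proof (rule Abs_partition_inverse, safe)
  show a: "antimono f" by (rule antimono_iff_le_Suc[THEN iffD2]) (use assms in auto)
  have "{i. f i \<noteq> 0} \<subseteq> {..<k}"
  proof
    fix i assume "i \<in> {i. f i \<noteq> 0}"
    then show "i \<in> {..<k}"
      using antimonoD[OF a, of k i] assms(2) by (cases "k \<le> i") auto
  qed
  then show "finite {i. f i \<noteq> 0}" by (rule finite_subset) simp
qed

lemma schur_interlacing_sum:
  assumes t: "0 < t" "t < 1"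
  shows "(\<Sum>m | interlace m l. t ^ psize m * schur t m) = schur t l"
proof -
  obtain k where k: "part l k = 0" using part_eventually_0 by blast
  define e where "e = (\<Sum>j<k. j * (k - 1 - j))"
  define b where "b = beta_number k l"
  let ?g = "\<lambda>m. (\<Prod>i<k. t ^ m i / qpoch t (m i)) * vdm k (\<lambda>i. t ^ m i)"
  \<comment> \<open>The shift by the staircase makes the lower interlacing inequality strict, hence
    the \<open>Suc\<close>.\<close>
  let ?B = "\<Pi>\<^sub>E i\<in>{0..<k}. {(if Suc i < k then Suc (b (Suc i)) else 0)..b i}"
  have km: "part m k = 0" if "interlace m l" for m
    using interlaceD(1)[OF that, of k] k by simp
  \<comment> \<open>The multiplier collects what the staircase contributes: \<open>t ^ e\<close>
    from \<open>schur_eq_vdm\<close>, and the powers t^0, ..., t^(k-1) from the product of the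
    t^(beta-number).\<close>
  have "(\<Sum>m | interlace m l. (t ^ psize m * schur t m) * (t ^ e * (\<Prod>j<k. t ^ j))) = (\<Sum>m\<in>?B. ?g m)"
  proof (rule sum.reindex_bij_witness[of _
        "\<lambda>m. Abs_partition (\<lambda>i. if i < k then m i - (k - 1 - i) else 0)"
        "\<lambda>m. restrict (beta_number k m) {0..<k}"])
    fix m assume m: "m \<in> {m. interlace m l}"
    then have m': "interlace m l" by simp
    have "(\<lambda>i. if i < k then restrict (beta_number k m) {0..<k} i - (k - 1 - i) else 0) = part m"
      by (rule ext) (auto simp: beta_number_def part_0_mono[OF km[OF m']])
    then show "Abs_partition (\<lambda>i. if i < k then restrict (beta_number k m) {0..<k} i - (k - 1 - i) else 0) = m"
      by (simp add: part_inverse)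
    show "restrict (beta_number k m) {0..<k} \<in> ?B"
    proof (rule restrict_PiE_iff[THEN iffD2], rule ballI)
      fix i assume "i \<in> {0..<k}"
      then show "beta_number k m i \<in> {(if Suc i < k then Suc (b (Suc i)) else 0)..b i}"
        using interlaceD[OF m', of i] unfolding b_def beta_number_def by auto
    qed
    have "?g (restrict (beta_number k m) {0..<k}) = (\<Prod>i<k. t ^ beta_number k m i / qpoch t (beta_number k m i)) * vdm k (\<lambda>i. t ^ beta_number k m i)"
      by (intro arg_cong2[where f = "(*)"] prod.cong fun_det_cong) auto
    also have "\<dots> = (\<Prod>i<k. t ^ beta_number k m i) * (schur t m * t ^ e)"
      unfolding e_def schur_eq_vdm[OF t km[OF m']] by (simp add: prod_dividef)
    also have "(\<Prod>i<k. t ^ beta_number k m i) = t ^ psize m * (\<Prod>i<k. t ^ (k - 1 - i))"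
      by (simp only: beta_number_def power_add prod.distrib psize_eq_sum[OF km[OF m']] power_sum)
    also have "(\<Prod>i<k. t ^ (k - 1 - i)) = (\<Prod>j<k. t ^ j)"
      using prod.nat_diff_reindex[of "\<lambda>j. t ^ j" k] by simp
    finally show "?g (restrict (beta_number k m) {0..<k}) = (t ^ psize m * schur t m) * (t ^ e * (\<Prod>j<k. t ^ j))"
      by (simp add: mult_ac)
  next
    fix f assume f: "f \<in> ?B"
    let ?p = "\<lambda>i. if i < k then f i - (k - 1 - i) else 0"
    have lo: "Suc (part l (Suc i) + (k - 1 - Suc i)) \<le> f i" if "Suc i < k" for i
      using PiE_mem[OF f, of i] that by (auto simp: b_def beta_number_def)
    have hi: "f i \<le> part l i + (k - 1 - i)" if "i < k" for i
      using PiE_mem[OF f, of i] that by (auto simp: b_def beta_number_def)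
    have lo': "part l (Suc i) \<le> ?p i" for i
    proof (cases "Suc i < k")
      case True
      then show ?thesis using lo[OF True] by simp
    qed (simp add: part_0_mono[OF k])
    have hi': "?p i \<le> part l i" for i
      using hi[of i] by auto
    have p: "part (Abs_partition ?p) = ?p"
      by (rule part_Abs_partition[where k = k]) (use lo' hi' le_trans in blast, simp)
    show "Abs_partition ?p \<in> {m. interlace m l}"
      unfolding interlace_def p mem_Collect_eq using lo' hi' by blast
    have ge: "k - 1 - i \<le> f i" if "i < k" for i
      using lo[of i] that by (cases "Suc i < k") auto
    show "restrict (beta_number k (Abs_partition ?p)) {0..<k} = f"
    proof
      fix i show "restrict (beta_number k (Abs_partition ?p)) {0..<k} i = f i"
        using PiE_arb[OF f, of i] ge[of i] by (auto simp: beta_number_def p)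
    qed
  qed
  also have "\<dots> = (\<Prod>j<k. t ^ j) * (vdm k (\<lambda>i. t ^ b i) / (\<Prod>i<k. qpoch t (b i)))"
    by (rule interlacing_vandermonde_sum[OF t]) (auto simp: b_def intro: beta_number_strict_antimono)
  also have "\<dots> = schur t l * (t ^ e * (\<Prod>j<k. t ^ j))"
    by (simp add: b_def schur_eq_vdm[OF t k, symmetric] e_def mult_ac)
  finally have "(\<Sum>m | interlace m l. t ^ psize m * schur t m) * (t ^ e * (\<Prod>j<k. t ^ j))
      = schur t l * (t ^ e * (\<Prod>j<k. t ^ j))"
    by (simp add: sum_distrib_right)
  moreover have "t ^ e * (\<Prod>j<k. t ^ j) > 0"
    using t by (intro mult_pos_pos prod_pos) auto
  ultimately show ?thesis using t by auto
qed

subsection \<open>Bender-Knuth involution and skew Cauchy identity\<close>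

lemma sum_split_first: "(\<Sum>i<Suc k. f i) = f 0 + (\<Sum>i<k. f (Suc i) :: nat)"
  by (rule sum.lessThan_Suc_shift)

text \<open>Row \<open>i\<close> of a partition between \<open>l\<close> and \<open>L\<close> ranges over an interval that does not depend
  on the other rows; reversing all these intervals is the Bender-Knuth involution.\<close>

lemma bender_knuth:
  "card {m. interlace l m \<and> interlace m L \<and> psize m = psize l + a}
 = card {m. interlace l m \<and> interlace m L \<and> psize L = psize m + a}"
proof -
  define lo where "lo i = max (part l i) (part L (Suc i))" for i
  define hi where "hi i = (if i = 0 then part L 0 else min (part L i) (part l (i - 1)))" for i
  define \<phi> where "\<phi> m = Abs_partition (\<lambda>i. lo i + hi i - part m i)" for m
  have mem: "interlace l m \<and> interlace m L \<longleftrightarrow> (\<forall>i. lo i \<le> part m i \<and> part m i \<le> hi i)" for m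
  proof
    assume *: "interlace l m \<and> interlace m L"
    show "\<forall>i. lo i \<le> part m i \<and> part m i \<le> hi i"
    proof
      fix i
      show "lo i \<le> part m i \<and> part m i \<le> hi i"
        using * by (cases i) (auto simp: interlace_def lo_def hi_def)
    qed
  next
    assume *: "\<forall>i. lo i \<le> part m i \<and> part m i \<le> hi i"
    have "part l i \<le> part m i" "part L (Suc i) \<le> part m i" "part m i \<le> part L i" for i
      using *[rule_format, of i] by (auto simp: lo_def hi_def split: if_splits)
    moreover have "part m (Suc i) \<le> part l i" for i
      using *[rule_format, of "Suc i"] by (auto simp: hi_def)
    ultimately show "interlace l m \<and> interlace m L"
      by (simp add: interlace_def)
  qed
  obtain k where k: "part L k = 0" using part_eventually_0 by blast
  have part_\<phi>: "part (\<phi> m) i = lo i + hi i - part m i"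
    if m: "interlace l m" "interlace m L" for m i
  proof -
    have b: "lo i \<le> part m i" "part m i \<le> hi i" for i
      using mem[of m] m by auto
    have "lo (Suc i) + hi (Suc i) - part m (Suc i) \<le> lo i + hi i - part m i" for i
    proof -
      \<comment> \<open>The intervals of successive rows lie one below the other, so any rowwise
        choice is weakly decreasing.\<close>
      have "hi (Suc i) \<le> lo i" by (auto simp: lo_def hi_def)
      then show ?thesis using b[of i] b[of "Suc i"] by linarith
    qed
    moreover have "lo k + hi k - part m k = 0"
    proof -
      have "hi k = 0" using k by (auto simp: hi_def)
      then show ?thesis using b[of k] by simp
    qed
    ultimately show ?thesis
      unfolding \<phi>_def by (subst part_Abs_partition[where k = k]) auto
  qed
  have \<phi>_mem: "interlace l (\<phi> m) \<and> interlace (\<phi> m) L"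
    if m: "interlace l m" "interlace m L" for m
  proof -
    have "lo i \<le> part m i \<and> part m i \<le> hi i" for i
      using mem[of m] m by auto
    then have "lo i \<le> part (\<phi> m) i \<and> part (\<phi> m) i \<le> hi i" for i
      unfolding part_\<phi>[OF m] by (metis add.commute add_le_mono1 diff_le_mono2 le_add_diff_inverse2 diff_add_inverse2 diff_add_inverse)
    then show ?thesis using mem by blast
  qed
  have \<phi>_\<phi>: "\<phi> (\<phi> m) = m" if m: "interlace l m" "interlace m L" for m
  proof (rule partition_eqI)
    fix i
    have "part m i \<le> hi i"
      using mem[of m] m by auto
    then show "part (\<phi> (\<phi> m)) i = part m i"
      using \<phi>_mem[OF m] by (simp add: part_\<phi>[OF m] part_\<phi>)
  qed
  \<comment> \<open>Telescoping: \<open>lo r\<close> and \<open>hi (Suc r)\<close> are the maximum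
    and the minimum of the same two parts.\<close>
  have sums: "(\<Sum>i<Suc r. lo i + hi i) = (\<Sum>i<r. part l i) + (\<Sum>i<Suc r. part L i) + lo r" for r
  proof (induction r)
    case (Suc r)
    have "lo r + hi (Suc r) = part l r + part L (Suc r)"
      by (simp add: lo_def hi_def max_def min_def)
    then show ?case
      using Suc by simp
  qed (simp add: hi_def)
  have size: "psize (\<phi> m) + psize m = psize l + psize L"
    if m: "interlace l m" "interlace m L" for m
  proof -
    have m0: "part m k = 0" using interlaceD(1)[OF m(2), of k] k by simp
    have l0: "part l k = 0" using interlaceD(1)[OF m(1), of k] m0 by simp
    have \<phi>0: "part (\<phi> m) k = 0" using interlaceD(1)[of "\<phi> m" L k] \<phi>_mem[OF m] k by simp
    note S = part_0_mono[OF _ le_SucI[OF order_refl]]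
    have "psize (\<phi> m) + psize m = (\<Sum>i<Suc k. part (\<phi> m) i + part m i)"
      using psize_eq_sum[OF S[OF m0]] psize_eq_sum[OF S[OF \<phi>0]] by (simp add: sum.distrib)
    also have "\<dots> = (\<Sum>i<Suc k. lo i + hi i)"
      by (intro sum.cong refl) (use mem[of m] m in \<open>auto simp: part_\<phi>[OF m] intro!: le_add_diff_inverse2 trans_le_add2\<close>)
    also have "\<dots> = psize l + psize L"
      unfolding sums psize_eq_sum[OF l0] psize_eq_sum[OF S[OF k]]
      using S[OF k] l0 by (simp add: lo_def)
    finally show ?thesis .
  qed
  show ?thesis
  proof (rule bij_betw_same_card[OF bij_betw_byWitness[where f = \<phi> and f' = \<phi>]])
    show "\<phi> ` {m. interlace l m \<and> interlace m L \<and> psize m = psize l + a}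
        \<subseteq> {m. interlace l m \<and> interlace m L \<and> psize L = psize m + a}"
      using \<phi>_mem size by fastforce
    show "\<phi> ` {m. interlace l m \<and> interlace m L \<and> psize L = psize m + a}
        \<subseteq> {m. interlace l m \<and> interlace m L \<and> psize m = psize l + a}"
      using \<phi>_mem size by fastforce
  qed (use \<phi>_\<phi> in auto)
qed

text \<open>The skew Cauchy identity in one variable: row \<open>i + 1\<close> of an upper bound and row \<open>i\<close> of a
  lower bound range over the same interval, and only row \<open>0\<close> of an upper bound is unbounded.\<close>

lemma skew_cauchy_step:
  "card {L. interlace l L \<and> interlace m L \<and> psize L = Suc s}
 = card {L. interlace l L \<and> interlace m L \<and> psize L = s}
 + card {v. interlace v l \<and> interlace v m \<and> psize v + Suc s = psize l + psize m}"
proof -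
  define top where "top = max (part l 0) (part m 0)"
  define lo where "lo i = max (part l (Suc i)) (part m (Suc i))" for i
  define hi where "hi i = min (part l i) (part m i)" for i
  define Up where "Up s = {L. interlace l L \<and> interlace m L \<and> psize L = s}" for s
  define Dn where "Dn = {v. interlace v l \<and> interlace v m \<and> psize v + Suc s = psize l + psize m}"
  have up: "interlace l L \<and> interlace m L \<longleftrightarrow>
      top \<le> part L 0 \<and> (\<forall>i. lo i \<le> part L (Suc i) \<and> part L (Suc i) \<le> hi i)" for L
  proof -
    have "(\<forall>i. part l i \<le> part L i \<and> part m i \<le> part L i) \<longleftrightarrow>
        top \<le> part L 0 \<and> (\<forall>i. lo i \<le> part L (Suc i))"
      by (auto simp: top_def lo_def) (metis nat.exhaust)+
    then show ?thesis
      by (auto simp: interlace_def hi_def)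
  qed
  have dn: "interlace v l \<and> interlace v m \<longleftrightarrow> (\<forall>i. lo i \<le> part v i \<and> part v i \<le> hi i)" for v
    by (auto simp: interlace_def hi_def lo_def)
  obtain k1 k2 where "part l k1 = 0" "part m k2 = 0" using part_eventually_0 by meson
  then obtain k where k: "part l k = 0" "part m k = 0"
    using part_0_mono[of l k1 "max k1 k2"] part_0_mono[of m k2 "max k1 k2"] by auto
  have fin: "finite (Up s)" for s
    by (rule finite_subset[OF _ finite_partitions_size[of s]]) (auto simp: Up_def)
  have hi_lo: "hi (Suc i) \<le> lo i" for i
    by (auto simp: hi_def lo_def)
  have hi_top: "hi 0 \<le> top" by (auto simp: hi_def top_def)
  have sums: "top + (\<Sum>i<r. lo i + hi i) = (\<Sum>i<r. part l i + part m i) + max (part l r) (part m r)" for r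
  proof (induction r)
    case (Suc r)
    have "max (part l r) (part m r) + hi r = part l r + part m r"
      by (simp add: hi_def max_def min_def)
    then show ?case
      using Suc by (simp add: lo_def)
  qed (simp add: top_def)
  then have sums: "top + (\<Sum>i<k. lo i + hi i) = psize l + psize m"
    by (simp add: k psize_eq_sum[OF k(1)] psize_eq_sum[OF k(2)] sum.distrib)

  \<comment> \<open>If the first row of \<open>L\<close> exceeds its minimum \<open>top\<close>, one
    box can be removed; if it equals \<open>top\<close>, the other rows correspond to a lower bound.
    This is the factor 1 - xy of the usual form of the identity.\<close>
  let ?A = "{L \<in> Up (Suc s). part L 0 = top}"
  let ?B = "{L \<in> Up (Suc s). part L 0 \<noteq> top}"
  have "card (Up (Suc s)) = card ?A + card ?B"
    by (subst card_Un_disjoint[symmetric]) (auto intro!: arg_cong[where f = card] finite_subset[OF _ fin])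
  also have "card ?B = card (Up s)"
  proof -
    define dec where "dec L = Abs_partition (\<lambda>i. if i = 0 then part L 0 - 1 else part L i)" for L
    define inc where "inc L = Abs_partition (\<lambda>i. if i = 0 then Suc (part L 0) else part L i)" for L
    have z: "part L (Suc k) = 0" if "interlace l L" for L
      using interlaceD(2)[OF that, of k] k by simp
    have ps: "psize L = part L 0 + (\<Sum>i<k. part L (Suc i))" if "interlace l L" for L
      using psize_eq_sum[OF z[OF that]] sum_split_first by simp
    have pinc: "part (inc L) = (\<lambda>i. if i = 0 then Suc (part L 0) else part L i)" if "interlace l L" for L
      unfolding inc_def
      by (rule part_Abs_partition[where k = "Suc k"])
         (use part_antimono[of _ _ L] z[OF that] in \<open>auto simp: le_SucI\<close>)
    have dec: "part (dec L) = (\<lambda>i. if i = 0 then part L 0 - 1 else part L i)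
        \<and> part L 0 > 0" if L: "L \<in> ?B" for L
    proof -
      have 1: "top < part L 0" and 2: "\<And>i. part L (Suc i) \<le> hi i"
        using L up[of L] by (auto simp: Up_def)
      \<comment> \<open>Row 1 is at most \<open>hi 0\<close>, hence at most \<open>top\<close>, so
        row 0 can lose a box.\<close>
      then have "part L (Suc 0) \<le> part L 0 - 1"
        using hi_top 2[of 0] by linarith
      then show ?thesis
        unfolding dec_def using L 1
        by (subst part_Abs_partition[where k = "Suc k"]) (auto simp: part_antimono z Up_def)
    qed
    show ?thesis
    proof (rule bij_betw_same_card[OF bij_betw_byWitness[where f = dec and f' = inc]])
      have 1: "dec L \<in> Up s" if L: "L \<in> ?B" for L
      proof -
        have "interlace l (dec L) \<and> interlace m (dec L)"
          using L dec[OF L] up[of L] up[of "dec L"] by (auto simp: Up_def)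
        then show ?thesis
          using L dec[OF L] ps[of L] ps[of "dec L"] by (auto simp: Up_def)
      qed
      have 2: "inc L \<in> ?B" if L: "L \<in> Up s" for L
      proof -
        have iL: "interlace l L" using L by (simp add: Up_def)
        have "interlace l (inc L) \<and> interlace m (inc L)" "part (inc L) 0 \<noteq> top"
          using L pinc[OF iL] up[of L] up[of "inc L"] by (auto simp: Up_def)
        then show ?thesis
          using L pinc[OF iL] ps[of L] ps[of "inc L"] by (auto simp: Up_def)
      qed
      show "dec ` ?B \<subseteq> Up s" "inc ` Up s \<subseteq> ?B" using 1 2 by auto
      show "\<forall>L\<in>?B. inc (dec L) = L"
      proof
        fix L assume L: "L \<in> ?B"
        then have "interlace l (dec L)" using 1 by (auto simp: Up_def)
        then show "inc (dec L) = L"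
          using dec[OF L] by (intro partition_eqI) (simp add: pinc)
      qed
      show "\<forall>L\<in>Up s. dec (inc L) = L"
      proof
        fix L assume L: "L \<in> Up s"
        then have "interlace l L" by (auto simp: Up_def)
        then show "dec (inc L) = L"
          using dec[OF 2[OF L]] by (intro partition_eqI) (simp add: pinc)
      qed
    qed
  qed
  also have "card ?A = card Dn"
  proof -
    \<comment> \<open>Copying the rows would also be a bijection between the boxes; reversing the
      intervals makes the sizes complementary, as \<open>Dn\<close> demands.\<close>
    define d where "d L = Abs_partition (\<lambda>i. lo i + hi i - part L (Suc i))" for L
    define u where "u v = Abs_partition (\<lambda>i. case i of 0 \<Rightarrow> top | Suc i \<Rightarrow> lo i + hi i - part v i)" for v
    have hik: "hi k = 0" using k by (simp add: hi_def)
    have bd: "lo i + hi i - x \<in> {lo i..hi i}" if "x \<in> {lo i..hi i}" for x i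
      using that by auto
    have antimono: "y \<le> x" if "x \<in> {lo i..hi i}" "y \<in> {lo (Suc i)..hi (Suc i)}" for x y i
      using that hi_lo[of i] by auto
    have Up_bd: "part L (Suc i) \<in> {lo i..hi i}" if "L \<in> ?A" for L i
      using that up[of L] by (auto simp: Up_def)
    have Dn_bd: "part v i \<in> {lo i..hi i}" if "v \<in> Dn" for v i
      using that dn[of v] by (auto simp: Dn_def)
    have pd: "part (d L) = (\<lambda>i. lo i + hi i - part L (Suc i))" if L: "L \<in> ?A" for L
      unfolding d_def
    proof (rule part_Abs_partition[where k = k])
      show "lo (Suc i) + hi (Suc i) - part L (Suc (Suc i)) \<le> lo i + hi i - part L (Suc i)" for i
        by (rule antimono[where i = i]) (intro bd Up_bd[OF L])+
      show "lo k + hi k - part L (Suc k) = 0"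
        using Up_bd[OF L, of k] hik by simp
    qed
    have pu: "part (u v) = (\<lambda>i. case i of 0 \<Rightarrow> top | Suc i \<Rightarrow> lo i + hi i - part v i)" if v: "v \<in> Dn" for v
      unfolding u_def
    proof (rule part_Abs_partition[where k = "Suc k"])
      show "(case Suc i of 0 \<Rightarrow> top | Suc i \<Rightarrow> lo i + hi i - part v i)
          \<le> (case i of 0 \<Rightarrow> top | Suc i \<Rightarrow> lo i + hi i - part v i)" for i
      proof (cases i)
        case 0
        then show ?thesis using bd[OF Dn_bd[OF v, of 0]] hi_top by auto
      next
        case (Suc j)
        then show ?thesis
          using antimono[OF bd[OF Dn_bd[OF v, of j]] bd[OF Dn_bd[OF v, of "Suc j"]]] by simp
      qed
      show "(case Suc k of 0 \<Rightarrow> top | Suc i \<Rightarrow> lo i + hi i - part v i) = 0"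
        using Dn_bd[OF v, of k] hik by simp
    qed
    show ?thesis
    proof (rule bij_betw_same_card[OF bij_betw_byWitness[where f = d and f' = u]])
      have 1: "d L \<in> Dn" if L: "L \<in> ?A" for L
      proof -
        have i: "interlace (d L) l \<and> interlace (d L) m"
          unfolding dn pd[OF L] using bd[OF Up_bd[OF L]] by auto
        have "part (d L) k = 0" using i k interlaceD(1)[of "d L" l k] by simp
        then have "psize (d L) = (\<Sum>i<k. part (d L) i)" by (rule psize_eq_sum)
        moreover have "part L (Suc k) = 0"
          using Up_bd[OF L, of k] hik by simp
        then have "psize L = top + (\<Sum>i<k. part L (Suc i))"
          using psize_eq_sum[of L "Suc k"] sum_split_first[of "part L" k] L by simp
        moreover have "(\<Sum>i<k. part (d L) i) + (\<Sum>i<k. part L (Suc i)) = (\<Sum>i<k. lo i + hi i)"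
          unfolding sum.distrib[symmetric] pd[OF L]
          by (intro sum.cong refl) (use Up_bd[OF L] in \<open>auto intro!: le_add_diff_inverse2 trans_le_add2\<close>)
        ultimately show ?thesis
          using L i sums by (auto simp: Dn_def Up_def)
      qed
      have 2: "u v \<in> ?A" if v: "v \<in> Dn" for v
      proof -
        have i: "interlace l (u v) \<and> interlace m (u v)"
          unfolding up pu[OF v] using bd[OF Dn_bd[OF v]] by auto
        have "part v k = 0" using Dn_bd[OF v, of k] hik by simp
        then have "psize v = (\<Sum>i<k. part v i)" by (rule psize_eq_sum)
        moreover have "part (u v) (Suc k) = 0"
          using interlaceD(2)[of l "u v" k] i k by simp
        then have "psize (u v) = top + (\<Sum>i<k. part (u v) (Suc i))"
          using psize_eq_sum[of "u v" "Suc k"] sum_split_first[of "part (u v)" k] pu[OF v] by simp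
        moreover have "(\<Sum>i<k. part (u v) (Suc i)) + (\<Sum>i<k. part v i) = (\<Sum>i<k. lo i + hi i)"
          unfolding sum.distrib[symmetric] pu[OF v]
          by (intro sum.cong refl) (use Dn_bd[OF v] in \<open>auto intro!: le_add_diff_inverse2 trans_le_add2\<close>)
        ultimately show ?thesis
          using v i sums by (auto simp: Dn_def Up_def pu[OF v])
      qed
      show "d ` ?A \<subseteq> Dn" "u ` Dn \<subseteq> ?A" using 1 2 by auto
      show "\<forall>L\<in>?A. u (d L) = L"
      proof
        fix L assume L: "L \<in> ?A"
        show "u (d L) = L"
        proof (rule partition_eqI)
          fix i show "part (u (d L)) i = part L i"
          proof (cases i)
            case (Suc j)
            then show ?thesis
              using Up_bd[OF L, of j] by (simp add: pu[OF 1[OF L]] pd[OF L])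
          qed (use L in \<open>simp add: pu[OF 1[OF L]]\<close>)
        qed
      qed
      show "\<forall>v\<in>Dn. d (u v) = v"
      proof
        fix v assume v: "v \<in> Dn"
        show "d (u v) = v"
        proof (rule partition_eqI)
          fix i show "part (d (u v)) i = part v i"
            using Dn_bd[OF v, of i] by (simp add: pd[OF 2[OF v]] pu[OF v])
        qed
      qed
    qed
  qed
  finally show ?thesis
    by (simp add: Up_def Dn_def)
qed

subsection \<open>Pieri's rule\<close>

lemma finite_interlace_below: "finite {m. interlace m l}"
  by (rule finite_subset[OF _ finite_partitions_size_le[of "psize l"]])
     (auto dest: interlace_psize_le)

lemma finite_partitions_size_conj: "finite {l. P l \<and> psize l = n}"
  by (rule finite_subset[OF _ finite_partitions_size[of n]]) auto

lemma sum_count_swap: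
  fixes g :: "'b \<Rightarrow> real"
  assumes "finite A" "finite B" "\<And>x. x \<in> A \<Longrightarrow> {y. R x y} \<subseteq> B"
  shows "(\<Sum>x\<in>A. \<Sum>y | R x y. g y) = (\<Sum>y\<in>B. g y * card {x \<in> A. R x y})"
proof -
  have "(\<Sum>x\<in>A. \<Sum>y | R x y. g y) = (\<Sum>x\<in>A. \<Sum>y | y \<in> B \<and> R x y. g y)"
    by (intro sum.cong refl) (use assms(3) in blast)
  also have "\<dots> = (\<Sum>y\<in>B. \<Sum>x | x \<in> A \<and> R x y. g y)"
    by (rule sum.swap_restrict[OF assms(1,2)])
  also have "\<dots> = (\<Sum>y\<in>B. g y * card {x \<in> A. R x y})"
    by (simp add: mult.commute)
  finally show ?thesis .
qed

text \<open>Expand each \<open>schur t L\<close> by the branching rule and apply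
  \<open>skew_cauchy_step\<close> to the number of common upper bounds \<open>L\<close> of
  \<open>l\<close> and \<open>m\<close>. Upper bounds with one box less give \<open>K a l\<close>.
  For a lower bound \<open>v\<close> the sizes force \<open>psize m = psize v + Suc a\<close>, so
  the sum over \<open>m\<close> is \<open>K (Suc a) v\<close> up to powers of t.\<close>

lemma schur_strip_sum_rec:
  fixes t :: real and K :: "nat \<Rightarrow> partition \<Rightarrow> real"
  assumes t: "0 < t" "t < 1"
    and K_def: "\<And>a l. K a l = (\<Sum>L | interlace l L \<and> psize L = psize l + a. schur t L)"
  shows "K (Suc a) l = K a l + t ^ Suc a * (\<Sum>v | interlace v l. t ^ psize v * K (Suc a) v)"
proof -
  define N where "N = psize l + Suc a"
  define g where "g m = t ^ psize m * schur t m" for m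
  \<comment> \<open>Large enough for both counts: \<open>m\<close> lies below some \<open>L\<close>
    of size at most N, or exceeds \<open>v\<close> in size by N - psize l, where \<open>v\<close>
    lies inside \<open>l\<close>.\<close>
  let ?T = "{m. psize m \<le> N}"
  let ?Up = "\<lambda>m s. {L. interlace l L \<and> interlace m L \<and> psize L = s}"
  let ?Dn = "\<lambda>m. {v. interlace v l \<and> interlace v m \<and> psize v + N = psize l + psize m}"
  have K: "(\<Sum>L | interlace l L \<and> psize L = s. schur t L) = (\<Sum>m\<in>?T. g m * card (?Up m s))"
    if "s \<le> N" for s
  proof -
    have "(\<Sum>L | interlace l L \<and> psize L = s. schur t L)
        = (\<Sum>L\<in>{L. interlace l L \<and> psize L = s}. \<Sum>m | interlace m L. g m)"
      by (simp add: schur_interlacing_sum[OF t] g_def)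
    also have "\<dots> = (\<Sum>m\<in>?T. g m * card {L \<in> {L. interlace l L \<and> psize L = s}. interlace m L})"
      by (intro sum_count_swap finite_partitions_size_conj finite_partitions_size_le)
         (use that interlace_psize_le le_trans in \<open>auto dest: interlace_psize_le\<close>)
    finally show ?thesis
      by (simp add: conj_ac)
  qed
  have "K (Suc a) l = (\<Sum>m\<in>?T. g m * card (?Up m N))"
    unfolding K_def N_def[symmetric] by (rule K) simp
  also have "\<dots> = (\<Sum>m\<in>?T. g m * (card (?Up m (psize l + a)) + card (?Dn m)))"
    unfolding N_def add_Suc_right skew_cauchy_step ..
  also have "\<dots> = K a l + (\<Sum>m\<in>?T. g m * card (?Dn m))"
    unfolding K_def by (subst K) (auto simp: N_def distrib_left sum.distrib)
  also have "(\<Sum>m\<in>?T. g m * card (?Dn m))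
      = (\<Sum>v | interlace v l. \<Sum>m | interlace v m \<and> psize v + N = psize l + psize m. g m)"
  proof -
    have "(\<Sum>v | interlace v l. \<Sum>m | interlace v m \<and> psize v + N = psize l + psize m. g m)
        = (\<Sum>m\<in>?T. g m * card {v \<in> {v. interlace v l}. interlace v m \<and> psize v + N = psize l + psize m})"
      by (rule sum_count_swap[OF finite_interlace_below finite_partitions_size_le])
         (auto dest: interlace_psize_le)
    then show ?thesis by simp
  qed
  also have "\<dots> = t ^ Suc a * (\<Sum>v | interlace v l. t ^ psize v * K (Suc a) v)"
    unfolding sum_distrib_left
  proof (rule sum.cong[OF refl])
    fix v
    have "(\<Sum>m | interlace v m \<and> psize v + N = psize l + psize m. g m)
        = (\<Sum>m | interlace v m \<and> psize m = psize v + Suc a. t ^ Suc a * (t ^ psize v * schur t m))"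
      by (rule sum.cong) (auto simp: N_def g_def power_add)
    then show "(\<Sum>m | interlace v m \<and> psize v + N = psize l + psize m. g m)
        = t ^ Suc a * (t ^ psize v * K (Suc a) v)"
      by (simp add: K_def sum_distrib_left)
  qed
  finally show ?thesis .
qed

text \<open>The factor 1 / qpoch t a is the complete symmetric function h_a at 1, t, t^2, .... In
  \<open>schur_strip_sum_rec\<close> the unknown at \<open>l\<close> recurs through v = l with a
  coefficient below 1, so values at smaller partitions determine it. The claimed value satisfies the
  same equation by the branching rule.\<close>

lemma schur_pieri:
  assumes t: "0 < t" "t < 1"
  shows "(\<Sum>L | interlace l L \<and> psize L = psize l + a. schur t L) = schur t l / qpoch t a"
proof (induction a arbitrary: l)
  case 0
  have "{L. interlace l L \<and> psize L = psize l + 0} = {l}"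
    by (auto dest: interlace_psize_eq[OF _ sym])
  then show ?case by simp
next
  case (Suc a)
  define KK where "KK a l = (\<Sum>L | interlace l L \<and> psize L = psize l + a. schur t L)" for a l
  define K where "K = KK (Suc a)"
  define Q where "Q = qpoch t (Suc a)"
  have Q: "Q = qpoch t a * (1 - t ^ Suc a)" "Q > 0"
    using qpoch_pos[OF t, of "Suc a"] by (simp_all only: Q_def qpoch_Suc)
  have "K l = schur t l / Q"
  proof (induction "psize l" arbitrary: l rule: less_induct)
    case less
    let ?I = "{v. interlace v l}"
    have split: "(\<Sum>v\<in>?I. f v) = f l + (\<Sum>v\<in>?I - {l}. f v)" for f :: "partition \<Rightarrow> real"
      by (intro sum.remove finite_interlace_below) simp
    have IH: "K v = schur t v / Q" if "v \<in> ?I - {l}" for v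
      using that interlace_psize_le[of v l] interlace_psize_eq[of v l]
      by (intro less) (auto simp: le_less)
    have "K l = schur t l / qpoch t a
        + t ^ Suc a * (t ^ psize l * K l + (\<Sum>v\<in>?I - {l}. t ^ psize v * (schur t v / Q)))"
      using schur_strip_sum_rec[OF t KK_def, of a l] Suc.IH[of l, folded KK_def] IH
      by (simp add: K_def[symmetric] split)
    moreover have "(\<Sum>v\<in>?I - {l}. t ^ psize v * (schur t v / Q)) = (schur t l - t ^ psize l * schur t l) / Q"
      using schur_interlacing_sum[OF t, of l] by (simp add: split sum_divide_distrib[symmetric])
    ultimately have eq: "K l = schur t l / qpoch t a
        + t ^ Suc a * (t ^ psize l * K l + (schur t l - t ^ psize l * schur t l) / Q)"
      by simp
    have "schur t l / qpoch t a = (1 - t ^ Suc a) * (schur t l / Q)"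
      using Q by (auto simp: divide_simps)
    with eq have "(1 - t ^ Suc a * t ^ psize l) * (K l - schur t l / Q) = 0"
      by (simp add: algebra_simps diff_divide_distrib)
    moreover have "t ^ Suc a * t ^ psize l < 1"
      using t power_less_one_iff[of t "Suc a + psize l"] by (simp add: power_add)
    ultimately show ?case by simp
  qed
  then show ?case by (simp add: K_def KK_def Q_def)
qed

subsection \<open>Exchanging inner and outer strips\<close>

text \<open>Up to normalisation, \<open>g l L\<close> is the probability of going from \<open>l\<close> to \<open>L\<close>, and it behaves like
  the skew Schur function of shape \<open>L/l\<close> at \<open>t, t^2, \<dots>\<close>. The hypothesis \<open>rec\<close> removes the
  largest variable from the inside.\<close>

locale skew_kernel =
  fixes t :: real and g :: "partition \<Rightarrow> partition \<Rightarrow> real"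
  assumes t: "0 < t" "t < 1"
  assumes diag: "g l l = 1"
  assumes triangular: "psize L \<le> psize l \<Longrightarrow> l \<noteq> L \<Longrightarrow> g l L = 0"
  assumes rec: "psize l \<le> psize L \<Longrightarrow>
    g l L = t ^ (psize L - psize l) * (\<Sum>m | interlace l m \<and> psize m \<le> psize L. g m L)"
begin

lemma finite_strip: "finite {m. interlace l m \<and> psize m \<le> n}"
  by (rule finite_subset[OF _ finite_partitions_size_le[of n]]) auto

lemma rec_bound:
  assumes "psize l \<le> psize L" "psize L \<le> n"
  shows "g l L = t ^ (psize L - psize l) * (\<Sum>m | interlace l m \<and> psize m \<le> n. g m L)"
proof -
  have "(\<Sum>m | interlace l m \<and> psize m \<le> psize L. g m L)
      = (\<Sum>m | interlace l m \<and> psize m \<le> n. g m L)"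
  proof (rule sum.mono_neutral_left[OF finite_strip])
    show "\<forall>m\<in>{m. interlace l m \<and> psize m \<le> n} - {m. interlace l m \<and> psize m \<le> psize L}. g m L = 0"
      by (auto intro!: triangular)
  qed (use assms in auto)
  with rec[OF assms(1)] show ?thesis by simp
qed

text \<open>Both sides, as functions X of \<open>l\<close>, satisfy X l = t^d times the sum of X
  over all strips on \<open>l\<close>. For the outer strip this is \<open>rec\<close>. For the inner
  strip, \<open>rec\<close> adds a second strip behind it and \<open>bender_knuth\<close> exchanges
  the two. If d > 0 the term X l is divided out and the others go by induction; if d = 0 only the
  strip itself remains.\<close>

lemma strip_commute:
  "psize l + a \<le> psize L \<Longrightarrow>
   (\<Sum>m | interlace l m \<and> psize m = psize l + a. g m L)
 = (\<Sum>m | interlace m L \<and> psize L = psize m + a. g l m)"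
proof (induction "psize L - psize l" arbitrary: l rule: less_induct)
  case less
  define X where "X l = (\<Sum>m | interlace l m \<and> psize m = psize l + a. g m L)" for l
  define Y where "Y l = (\<Sum>m | interlace m L \<and> psize L = psize m + a. g l m)" for l
  define d where "d = psize L - psize l - a"
  have sz: "psize L = psize l + a + d" using less.prems by (simp add: d_def)
  define T where "T = {n. psize n \<le> psize L + a}"
  define A where "A = {m. interlace l m \<and> psize m = psize l + a}"
  define M where "M = {m. interlace m L \<and> psize L = psize m + a}"
  define I where "I = {m. interlace l m \<and> psize m \<le> psize L}"
  have finT: "finite T" unfolding T_def by (rule finite_partitions_size_le)
  have finA: "finite A" unfolding A_def by (rule finite_partitions_size_conj)
  have finI: "finite I" unfolding I_def by (rule finite_strip)
  note fin = finT finA finI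
  have finM: "finite M"
    by (rule finite_subset[OF _ finite_interlace_below[of L]]) (auto simp: M_def)
  have "X l = Y l"
  proof (cases "d = 0")
    case True
    have "g m L = (if m = L then 1 else 0)" if "m \<in> A" for m
      using triangular[of L m] diag that sz True by (auto simp: A_def)
    then have "X l = (if L \<in> A then 1 else 0)"
      using fin unfolding X_def A_def[symmetric] by simp
    moreover have "g l m = (if m = l then 1 else 0)" if "m \<in> M" for m
      using triangular[of m l] diag that sz True by (auto simp: M_def)
    then have "Y l = (if l \<in> M then 1 else 0)"
      using finM unfolding Y_def M_def[symmetric] by simp
    ultimately show ?thesis
      using sz True by (simp add: A_def M_def)
  next
    case False
    \<comment> \<open>Raising the bound to \<open>psize L + a\<close> adds only zero terms, and
      makes room for a strip of size a on every member of \<open>I\<close>.\<close>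
    have "X l = (\<Sum>m\<in>A. \<Sum>n | interlace m n \<and> psize n \<le> psize L + a. t ^ d * g n L)"
      unfolding X_def A_def[symmetric]
    proof (rule sum.cong[OF refl])
      fix m assume "m \<in> A"
      then show "g m L = (\<Sum>n | interlace m n \<and> psize n \<le> psize L + a. t ^ d * g n L)"
        unfolding sum_distrib_left[symmetric]
        by (subst rec_bound[of _ L "psize L + a"]) (auto simp: A_def sz)
    qed
    also have "\<dots> = (\<Sum>n\<in>T. t ^ d * g n L * card {m \<in> A. interlace m n \<and> psize n \<le> psize L + a})"
      by (rule sum_count_swap) (use fin in \<open>auto simp: T_def\<close>)
    also have "\<dots> = (\<Sum>n\<in>T. t ^ d * g n L * card {m. interlace l m \<and> interlace m n \<and> psize m = psize l + a})"
      by (intro sum.cong refl arg_cong2[where f = "(*)"] arg_cong[where f = "\<lambda>S. real (card S)"])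
         (auto simp: A_def T_def)
    also have "\<dots> = (\<Sum>n\<in>T. t ^ d * g n L * card {m \<in> I. interlace m n \<and> psize n = psize m + a})"
      unfolding bender_knuth
      by (intro sum.cong refl arg_cong2[where f = "(*)"] arg_cong[where f = "\<lambda>S. real (card S)"])
         (auto simp: I_def T_def)
    also have "\<dots> = (\<Sum>m\<in>I. \<Sum>n | interlace m n \<and> psize n = psize m + a. t ^ d * g n L)"
      by (rule sum_count_swap[symmetric]) (use fin in \<open>auto simp: T_def I_def\<close>)
    finally have X: "X l = t ^ d * sum X I"
      by (simp add: X_def sum_distrib_left)
    have "Y l = (\<Sum>m\<in>M. \<Sum>n\<in>I. t ^ d * g n m)"
      unfolding Y_def M_def[symmetric]
    proof (rule sum.cong[OF refl])
      fix m assume "m \<in> M"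
      then have "psize m = psize l + d" using sz by (simp add: M_def)
      then show "g l m = (\<Sum>n\<in>I. t ^ d * g n m)"
        unfolding sum_distrib_left[symmetric] I_def
        using rec_bound[of l m "psize L"] sz by simp
    qed
    also have "\<dots> = (\<Sum>n\<in>I. \<Sum>m\<in>M. t ^ d * g n m)"
      by (rule sum.swap)
    finally have Y: "Y l = t ^ d * sum Y I"
      by (simp add: Y_def M_def sum_distrib_left)
    have "X m = Y m" if m: "m \<in> I - {l}" for m
    proof (cases "psize m + a \<le> psize L")
      case True
      have "psize l < psize m"
        using m interlace_psize_le[of l m] interlace_psize_eq[of l m] by (auto simp: I_def le_less)
      then show ?thesis
        unfolding X_def Y_def by (intro less.hyps True) (use True in linarith)
    next
      case False
      then have "X m = 0" "Y m = 0"
        unfolding X_def Y_def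
        by (auto intro!: sum.neutral triangular)
      then show ?thesis by simp
    qed
    then have "sum X I = X l + sum Y (I - {l})" "sum Y I = Y l + sum Y (I - {l})"
      using fin sum.remove[of I l X] sum.remove[of I l Y] sz by (simp_all add: I_def)
    with X Y have "(1 - t ^ d) * (X l - Y l) = 0"
      by (simp add: algebra_simps)
    moreover have "t ^ d < 1"
      using t False by (simp add: power_less_one_iff)
    ultimately show ?thesis by simp
  qed
  then show ?case by (simp add: X_def Y_def)
qed

text \<open>\<open>rec\<close> moves the start away from the empty partition;
  \<open>strip_commute\<close>, used for each strip size, moves it back. The resulting equation
  expresses f L by all f m with L - m a strip, and the branching rule shows that the claimed value
  solves it.\<close>

lemma kernel_from_empty: "g empty_partition L = t ^ psize L * schur t L"
proof (induction "psize L" arbitrary: L rule: less_induct)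
  case less
  show ?case
  proof (cases "L = empty_partition")
    case True
    have "schur t empty_partition = 1"
      by (simp add: schur_def n_stat_def diagram_def)
    with True show ?thesis by (simp add: diag)
  next
    case False
    define f where "f L = g empty_partition L" for L
    let ?I = "{m. interlace m L}"
    have pos: "psize L > 0" using False psize_eq_0_iff by auto
    have "f L = t ^ psize L * (\<Sum>m | interlace empty_partition m \<and> psize m \<le> psize L. g m L)"
      unfolding f_def by (subst rec) simp_all
    also have "(\<Sum>m | interlace empty_partition m \<and> psize m \<le> psize L. g m L)
        = (\<Sum>a\<le>psize L. \<Sum>m | interlace empty_partition m \<and> psize m = psize empty_partition + a. g m L)"
      by (subst sum.group[symmetric, where g = psize and T = "{..psize L}"])
         (auto simp: finite_strip intro!: sum.cong)
    also have "\<dots> = (\<Sum>a\<le>psize L. \<Sum>m | interlace m L \<and> psize L = psize m + a. f m)"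
      unfolding f_def by (intro sum.cong refl strip_commute) simp
    also have "\<dots> = sum f ?I"
      by (subst sum.group[symmetric, where g = "\<lambda>m. psize L - psize m" and T = "{..psize L}"])
         (auto simp: finite_interlace_below intro!: sum.cong dest: interlace_psize_le)
    also have "\<dots> = f L + sum f (?I - {L})"
      by (intro sum.remove finite_interlace_below) simp
    also have "sum f (?I - {L}) = (\<Sum>m\<in>?I - {L}. t ^ psize m * schur t m)"
    proof (rule sum.cong[OF refl])
      fix m assume "m \<in> ?I - {L}"
      then have "psize m < psize L"
        using interlace_psize_le[of m L] interlace_psize_eq[of m L] by (auto simp: le_less)
      then show "f m = t ^ psize m * schur t m"
        unfolding f_def by (rule less)
    qed
    also have "\<dots> = schur t L - t ^ psize L * schur t L"
      using schur_interlacing_sum[OF t, of L]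
        sum.remove[OF finite_interlace_below[of L], of L "\<lambda>m. t ^ psize m * schur t m"] by simp
    finally have "(1 - t ^ psize L) * (f L - t ^ psize L * schur t L) = 0"
      by (simp add: algebra_simps)
    moreover have "t ^ psize L < 1"
      using t pos by (simp add: power_less_one_iff)
    ultimately show ?thesis by (simp add: f_def)
  qed
qed

end

subsection \<open>The sums defining \<open>J\<close>\<close>

definition seq_weight :: "real \<Rightarrow> (nat \<Rightarrow> nat) \<Rightarrow> real" where
  "seq_weight t f = t ^ (\<Sum>i | f i \<noteq> 0. (i + 1) * f i) / (\<Prod>i | f i \<noteq> 0. qpoch t (f i))"

definition seq_sum :: "real \<Rightarrow> nat \<Rightarrow> real" where
  "seq_sum t a = (\<Sum>\<^sub>\<infinity>f\<in>sequences_of_sum a. seq_weight t f)"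

text \<open>Finite truncations exhausting \<open>sequences_of_sum a\<close>; bounding their sums
  uniformly in k gives summability.\<close>

definition seqs_below :: "nat \<Rightarrow> nat \<Rightarrow> (nat \<Rightarrow> nat) set" where
  "seqs_below k a = {f. (\<forall>i\<ge>k. f i = 0) \<and> (\<Sum>i<k. f i) = a}"

lemma support_subset: "\<forall>i\<ge>k. f i = 0 \<Longrightarrow> {i. f i \<noteq> (0::nat)} \<subseteq> {..<k::nat}"
  by (rule subsetI) (metis lessThan_iff mem_Collect_eq not_le)

lemma seq_weight_below:
  assumes "\<forall>i\<ge>k. f i = 0"
  shows "seq_weight t f = t ^ (\<Sum>i<k. (i + 1) * f i) / (\<Prod>i<k. qpoch t (f i))"
proof -
  have "(\<Sum>i | f i \<noteq> 0. (i + 1) * f i) = (\<Sum>i<k. (i + 1) * f i)"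
    by (rule sum.mono_neutral_left) (use support_subset[OF assms] in auto)
  moreover have "(\<Prod>i | f i \<noteq> 0. qpoch t (f i)) = (\<Prod>i<k. qpoch t (f i))"
    by (rule prod.mono_neutral_left) (use support_subset[OF assms] in auto)
  ultimately show ?thesis by (simp add: seq_weight_def)
qed

lemma sequences_of_sum_eq: "sequences_of_sum a = (\<Union>k. seqs_below k a)"
proof (intro equalityI subsetI)
  fix f assume f: "f \<in> sequences_of_sum a"
  then have "finite {i. f i \<noteq> 0}" by (simp add: sequences_of_sum_def)
  then obtain k where k: "\<forall>i\<in>{i. f i \<noteq> 0}. i < k"
    using finite_nat_set_iff_bounded by blast
  then have 0: "\<forall>i\<ge>k. f i = 0" by (metis leD mem_Collect_eq)
  have "(\<Sum>i | f i \<noteq> 0. f i) = (\<Sum>i<k. f i)"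
    by (rule sum.mono_neutral_left) (use support_subset[OF 0] in auto)
  with f 0 show "f \<in> (\<Union>k. seqs_below k a)"
    by (auto simp: sequences_of_sum_def seqs_below_def)
next
  fix f assume "f \<in> (\<Union>k. seqs_below k a)"
  then obtain k where 0: "\<forall>i\<ge>k. f i = 0" and s: "(\<Sum>i<k. f i) = a"
    by (auto simp: seqs_below_def)
  have "(\<Sum>i | f i \<noteq> 0. f i) = (\<Sum>i<k. f i)"
    by (rule sum.mono_neutral_left) (use support_subset[OF 0] in auto)
  moreover have "finite {i. f i \<noteq> 0}"
    using support_subset[OF 0] finite_subset by blast
  ultimately show "f \<in> sequences_of_sum a"
    using s by (simp add: sequences_of_sum_def)
qed

lemma seqs_below_mono: "k \<le> k' \<Longrightarrow> seqs_below k a \<subseteq> seqs_below k' a"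
proof
  fix f assume "k \<le> k'" "f \<in> seqs_below k a"
  moreover from this have "(\<Sum>i<k. f i) = (\<Sum>i<k'. f i)"
    by (intro sum.mono_neutral_left) (auto simp: seqs_below_def)
  ultimately show "f \<in> seqs_below k' a"
    by (auto simp: seqs_below_def)
qed

definition seq_cons :: "nat \<times> (nat \<Rightarrow> nat) \<Rightarrow> nat \<Rightarrow> nat" where
  "seq_cons = (\<lambda>(a, f) i. case i of 0 \<Rightarrow> a | Suc j \<Rightarrow> f j)"

lemma seq_cons_simps [simp]: "seq_cons (a, f) 0 = a" "seq_cons (a, f) (Suc i) = f i"
  by (simp_all add: seq_cons_def)

lemma inj_seq_cons: "inj seq_cons"
proof (rule injI)
  fix x y :: "nat \<times> (nat \<Rightarrow> nat)" assume eq: "seq_cons x = seq_cons y"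
  obtain a f b g where [simp]: "x = (a, f)" "y = (b, g)" by fastforce
  have "a = b" using fun_cong[OF eq, of 0] by simp
  moreover have "f = g"
  proof
    fix i show "f i = g i" using fun_cong[OF eq, of "Suc i"] by simp
  qed
  ultimately show "x = y" by simp
qed

lemma seqs_below_Suc: "seqs_below (Suc k) m = seq_cons ` (SIGMA a:{..m}. seqs_below k (m - a))"
proof (intro equalityI subsetI)
  fix f assume f: "f \<in> seqs_below (Suc k) m"
  then have s: "f 0 + (\<Sum>i<k. f (Suc i)) = m"
    by (simp only: seqs_below_def mem_Collect_eq sum.lessThan_Suc_shift)
  have "f = seq_cons (f 0, \<lambda>i. f (Suc i))"
    by (rule ext) (simp add: seq_cons_def split: nat.split)
  moreover have "(f 0, \<lambda>i. f (Suc i)) \<in> (SIGMA a:{..m}. seqs_below k (m - a))"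
    using f s by (auto simp: seqs_below_def)
  ultimately show "f \<in> seq_cons ` (SIGMA a:{..m}. seqs_below k (m - a))"
    by (rule image_eqI)
next
  fix f assume "f \<in> seq_cons ` (SIGMA a:{..m}. seqs_below k (m - a))"
  then obtain a g where f: "f = seq_cons (a, g)" and a: "a \<le> m" and g: "g \<in> seqs_below k (m - a)"
    by auto
  have "f i = 0" if "i \<ge> Suc k" for i
    using that g f by (cases i) (auto simp: seqs_below_def)
  moreover have "(\<Sum>i<Suc k. f i) = m"
    using a g unfolding sum.lessThan_Suc_shift f by (simp add: seqs_below_def)
  ultimately show "f \<in> seqs_below (Suc k) m"
    by (simp add: seqs_below_def)
qed

text \<open>Moving every index up by one adds the sum m - a of the entries to the exponent. Together
  with a from the new first entry this gives t^m, independently of a.\<close>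

lemma seq_weight_cons:
  assumes g: "g \<in> seqs_below k (m - a)" and a: "a \<le> m"
  shows "seq_weight t (seq_cons (a, g)) = t ^ m / qpoch t a * seq_weight t g"
proof -
  have "seq_cons (a, g) \<in> seqs_below (Suc k) m"
    unfolding seqs_below_Suc using assms by blast
  then have 0: "\<forall>i\<ge>Suc k. seq_cons (a, g) i = 0" by (simp add: seqs_below_def)
  have "(\<Sum>i<k. (Suc i + 1) * g i) = (\<Sum>i<k. (i + 1) * g i) + (\<Sum>i<k. g i)"
    by (simp add: sum.distrib)
  then have e: "a + (\<Sum>i<k. (Suc i + 1) * g i) = m + (\<Sum>i<k. (i + 1) * g i)"
    using g a by (simp add: seqs_below_def)
  have "seq_weight t (seq_cons (a, g))
      = t ^ (a + (\<Sum>i<k. (Suc i + 1) * g i)) / (qpoch t a * (\<Prod>i<k. qpoch t (g i)))"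
    unfolding seq_weight_below[OF 0] sum.lessThan_Suc_shift prod.lessThan_Suc_shift by simp
  also have "\<dots> = t ^ m / qpoch t a * seq_weight t g"
    unfolding e using g by (subst seq_weight_below[of k]) (auto simp: seqs_below_def power_add)
  finally show ?thesis .
qed

lemma sequences_of_sum_cons:
  "sequences_of_sum m = seq_cons ` (SIGMA a:{..m}. sequences_of_sum (m - a))"
proof -
  have "sequences_of_sum m = (\<Union>k. seqs_below (Suc k) m)"
    unfolding sequences_of_sum_eq using seqs_below_mono[OF le_SucI[OF order_refl], of _ m] by blast
  then show ?thesis
    unfolding seqs_below_Suc sequences_of_sum_eq by blast
qed

lemma finite_seqs_below: "finite (seqs_below k m)"
proof (induction k arbitrary: m)
  case 0
  have "seqs_below 0 m \<subseteq> {\<lambda>_. 0}" by (auto simp: seqs_below_def)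
  then show ?case by (rule finite_subset) simp
qed (simp add: seqs_below_Suc)

section \<open>Summability and recursion of the sequence sums\<close>

context
  fixes t :: real
  assumes t: "0 < t" "t < 1"
begin

lemma seq_weight_nonneg: "seq_weight t f \<ge> 0"
  unfolding seq_weight_def using t
  by (intro divide_nonneg_nonneg prod_nonneg) (auto intro: less_imp_le qpoch_pos)

lemma seqs_below_sum_Suc:
  "sum (seq_weight t) (seqs_below (Suc k) m)
 = (\<Sum>a\<le>m. t ^ m / qpoch t a * sum (seq_weight t) (seqs_below k (m - a)))"
proof -
  have "sum (seq_weight t) (seqs_below (Suc k) m)
      = (\<Sum>(a, g)\<in>(SIGMA a:{..m}. seqs_below k (m - a)). seq_weight t (seq_cons (a, g)))"
    unfolding seqs_below_Suc
    by (subst sum.reindex) (auto intro: inj_on_subset[OF inj_seq_cons] simp: case_prod_beta)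
  also have "\<dots> = (\<Sum>a\<le>m. \<Sum>g\<in>seqs_below k (m - a). seq_weight t (seq_cons (a, g)))"
    by (subst sum.Sigma) (auto simp: finite_seqs_below)
  also have "\<dots> = (\<Sum>a\<le>m. t ^ m / qpoch t a * sum (seq_weight t) (seqs_below k (m - a)))"
    unfolding sum_distrib_left by (intro sum.cong refl seq_weight_cons) auto
  finally show ?thesis .
qed

lemma seqs_below_sum_bounded: "\<exists>B. \<forall>k. sum (seq_weight t) (seqs_below k m) \<le> B"
proof (induction m rule: less_induct)
  case (less m)
  define S where "S k m = sum (seq_weight t) (seqs_below k m)" for k m
  from less obtain B where B: "\<And>j k. j < m \<Longrightarrow> S k j \<le> B j"
    unfolding S_def by metis
  define C where "C = (\<Sum>a\<in>{1..m}. t ^ m / qpoch t a * \<bar>B (m - a)\<bar>)"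
  have S0: "S 0 m \<le> 1"
  proof -
    have "seqs_below 0 m \<subseteq> {\<lambda>_. 0}" by (auto simp: seqs_below_def)
    then have "S 0 m \<le> sum (seq_weight t) {\<lambda>_. 0}"
      unfolding S_def by (intro sum_mono2) (auto simp: seq_weight_nonneg)
    then show ?thesis by (simp add: seq_weight_def)
  qed
  have step: "S (Suc k) m \<le> t ^ m * S k m + C" for k
  proof -
    have "{..m} = insert 0 {1..m}" by auto
    then have "S (Suc k) m = t ^ m * S k m + (\<Sum>a\<in>{1..m}. t ^ m / qpoch t a * S k (m - a))"
      unfolding S_def seqs_below_sum_Suc by simp
    also have "\<dots> \<le> t ^ m * S k m + C"
      unfolding C_def using t qpoch_pos[OF t]
      by (intro add_left_mono sum_mono mult_left_mono) (auto intro: order_trans[OF B abs_ge_self] simp: less_imp_le)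
    finally show ?thesis .
  qed
  show ?case
  proof (cases "m = 0")
    case True
    have "S k m \<le> 1" for k
      using step S0 True by (induction k) (auto simp: C_def intro: order_trans)
    then show ?thesis by (auto simp: S_def)
  next
    case False
    then have tm: "t ^ m < 1" using t by (simp add: power_less_one_iff)
    have "C \<ge> 0"
      unfolding C_def using t qpoch_pos[OF t] by (intro sum_nonneg) (auto simp: less_imp_le)
    \<comment> \<open>\<open>C / (1 - t ^ m)\<close> is the fixed point of x |-> t^m x + C; the
      added 1 covers the start \<open>S 0 m\<close>.\<close>
    define D where "D = 1 + C / (1 - t ^ m)"
    have D: "t ^ m * D + C \<le> D"
    proof -
      have "D * (1 - t ^ m) = (1 - t ^ m) + C"
        using tm by (simp add: D_def distrib_right)
      then show ?thesis using tm by (simp add: algebra_simps)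
    qed
    have "S k m \<le> D" for k
    proof (induction k)
      case 0
      then show ?case using S0 \<open>C \<ge> 0\<close> tm by (simp add: D_def add_increasing2)
    next
      case (Suc k)
      have "t ^ m * S k m \<le> t ^ m * D" using Suc t by (intro mult_left_mono) auto
      then show ?case using step[of k] D by linarith
    qed
    then show ?thesis by (auto simp: S_def)
  qed
qed

lemma seq_weight_summable: "seq_weight t summable_on sequences_of_sum m"
proof (rule nonneg_bdd_above_summable_on)
  from seqs_below_sum_bounded obtain B where B: "\<And>k. sum (seq_weight t) (seqs_below k m) \<le> B"
    by blast
  show "bdd_above (sum (seq_weight t) ` {F. F \<subseteq> sequences_of_sum m \<and> finite F})"
  proof (rule bdd_aboveI2)
    fix F assume F: "F \<in> {F. F \<subseteq> sequences_of_sum m \<and> finite F}"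
    then have "\<forall>f\<in>F. \<exists>k. f \<in> seqs_below k m" by (auto simp: sequences_of_sum_eq)
    then obtain K where K: "\<And>f. f \<in> F \<Longrightarrow> f \<in> seqs_below (K f) m" by metis
    have "F \<subseteq> seqs_below (\<Sum>f\<in>F. K f) m"
      using K F seqs_below_mono[OF member_le_sum[of _ F K]] by blast
    then have "sum (seq_weight t) F \<le> sum (seq_weight t) (seqs_below (\<Sum>f\<in>F. K f) m)"
      by (intro sum_mono2) (auto simp: finite_seqs_below seq_weight_nonneg)
    then show "sum (seq_weight t) F \<le> B" using B order_trans by blast
  qed
qed (simp add: seq_weight_nonneg)

text \<open>The first entry n_1 = a is split off. Divided by \<open>seq_sum t m\<close>, this says
  that the size probabilities sum to 1.\<close>

lemma seq_sum_rec: "seq_sum t m = (\<Sum>a\<le>m. t ^ m / qpoch t a * seq_sum t (m - a))"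
proof -
  let ?S = "SIGMA a:{..m}. sequences_of_sum (m - a)"
  have bij: "bij_betw seq_cons ?S (sequences_of_sum m)"
    unfolding bij_betw_def sequences_of_sum_cons[of m] using inj_on_subset[OF inj_seq_cons] by auto
  have "seq_sum t m = (\<Sum>\<^sub>\<infinity>x\<in>?S. seq_weight t (seq_cons x))"
    unfolding seq_sum_def by (rule infsum_reindex_bij_betw[OF bij, symmetric])
  also have "\<dots> = (\<Sum>\<^sub>\<infinity>a\<in>{..m}. \<Sum>\<^sub>\<infinity>g\<in>sequences_of_sum (m - a). seq_weight t (seq_cons (a, g)))"
    by (rule infsum_Sigma_banach[symmetric])
       (use summable_on_reindex_bij_betw[OF bij, of "seq_weight t"] seq_weight_summable in blast)
  also have "\<dots> = (\<Sum>a\<le>m. \<Sum>\<^sub>\<infinity>g\<in>sequences_of_sum (m - a). t ^ m / qpoch t a * seq_weight t g)"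
    unfolding infsum_finite[OF finite_atMost]
  proof (intro sum.cong refl infsum_cong)
    fix a g assume "a \<in> {..m}" "g \<in> sequences_of_sum (m - a)"
    then show "seq_weight t (seq_cons (a, g)) = t ^ m / qpoch t a * seq_weight t g"
      unfolding sequences_of_sum_eq by (blast intro: seq_weight_cons)
  qed
  also have "\<dots> = (\<Sum>a\<le>m. t ^ m / qpoch t a * seq_sum t (m - a))"
    by (simp only: infsum_cmult_right' seq_sum_def)
  finally show ?thesis .
qed

lemma seq_sum_0: "seq_sum t 0 = 1"
proof -
  have "sequences_of_sum 0 = {\<lambda>_. 0}"
  proof (intro equalityI subsetI)
    fix f assume "f \<in> sequences_of_sum 0"
    then have "f i = 0" for i
      by (cases "f i = 0") (auto simp: sequences_of_sum_def)
    then show "f \<in> {\<lambda>_. 0}" by auto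
  qed (auto simp: sequences_of_sum_def)
  then show ?thesis by (simp add: seq_sum_def seq_weight_def)
qed

lemma seq_sum_pos: "seq_sum t m > 0"
proof -
  have nn: "seq_sum t a \<ge> 0" for a
    unfolding seq_sum_def by (rule infsum_nonneg) (rule seq_weight_nonneg)
  have "0 < t ^ m / qpoch t m * seq_sum t (m - m)"
    using t qpoch_pos[OF t] by (simp add: seq_sum_0)
  also have "\<dots> \<le> (\<Sum>a\<le>m. t ^ m / qpoch t a * seq_sum t (m - a))"
    using t qpoch_pos[OF t] nn by (intro member_le_sum) (auto simp: less_imp_le)
  finally show ?thesis by (simp only: seq_sum_rec[symmetric])
qed

end

lemma J_eq_seq_sum:
  "J a q = q ^ (a\<^sup>2) * (\<Prod>i=1..a. (1 - 1 / q ^ i)\<^sup>2) * seq_sum (1 / q) a"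
  unfolding J_def seq_sum_def seq_weight_def
  by (simp add: qfac_eq_qpoch power_one_over)

lemma size_prob_eq:
  assumes q: "q > 1"
  shows "size_prob q m a =
    (if a \<le> m then (1 / q) ^ m / qpoch (1 / q) a * (seq_sum (1 / q) (m - a) / seq_sum (1 / q) m) else 0)"
proof (cases "a \<le> m")
  case True
  define R where "R A = (\<Prod>i\<in>A. (1 - 1 / q ^ i)\<^sup>2)" for A
  have t: "0 < 1 / q" "1 / q < 1" using q by auto
  have Rnz: "R {1..k} \<noteq> 0" for k
  proof -
    have "1 - 1 / q ^ i \<noteq> 0" if "i \<in> {1..k}" for i
      using one_less_power[OF q, of i] that by auto
    then show ?thesis by (auto simp: R_def)
  qed
  have "{1..m} = {1..m - a} \<union> {m - a + 1..m}" using True by auto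
  then have R: "R {1..m} = R {1..m - a} * R {m - a + 1..m}"
    unfolding R_def by (subst prod.union_disjoint[symmetric]) auto
  with Rnz have nz: "R {m - a + 1..m} \<noteq> 0" "R {1..m - a} \<noteq> 0" by (metis mult_zero_right)+
  have P: "seq_sum (1 / q) m > 0" by (rule seq_sum_pos[OF t])
  have Q: "qpoch (1 / q) a > 0" by (rule qpoch_pos[OF t])
  have "size_prob q m a = q ^ (m\<^sup>2) * R {m - a + 1..m} / (q ^ ((m - a)\<^sup>2 + m) * qpoch (1 / q) a)
     * ((q ^ ((m - a)\<^sup>2) * R {1..m - a} * seq_sum (1 / q) (m - a)) / (q ^ (m\<^sup>2) * R {1..m} * seq_sum (1 / q) m))"
    using True by (simp add: size_prob_def J_eq_seq_sum R_def qfac_eq_qpoch)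
  also have "\<dots> = (1 / q) ^ m / qpoch (1 / q) a * (seq_sum (1 / q) (m - a) / seq_sum (1 / q) m)"
    unfolding R power_add power_one_over using nz P Q q by (simp add: field_simps)
  finally show ?thesis using True by simp
qed (simp add: size_prob_def)

subsection \<open>The normalising constant of \<open>M_Pl\<close>\<close>

lemma prodinf_pos_unit:
  fixes f :: "nat \<Rightarrow> real"
  assumes f: "\<And>n. 0 < f n" "\<And>n. f n \<le> 1" and s: "summable (\<lambda>n. 1 - f n)"
  shows "0 < prodinf f" "prodinf f \<le> 1" "(\<lambda>n. \<Prod>i\<le>n. f i) \<longlonglongrightarrow> prodinf f"
proof -
  have "norm (f n - 1) = 1 - f n" for n using f(2)[of n] by simp
  then have c: "convergent_prod f"
    using s by (intro abs_convergent_prod_imp_convergent_prod summable_imp_abs_convergent_prod) simp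
  show l: "(\<lambda>n. \<Prod>i\<le>n. f i) \<longlonglongrightarrow> prodinf f"
    by (rule convergent_prod_LIMSEQ[OF c])
  have "0 \<le> (\<Prod>i\<le>n. f i)" "(\<Prod>i\<le>n. f i) \<le> 1" for n
    using f by (auto intro!: prod_nonneg prod_le_1 simp: less_imp_le)
  then have "0 \<le> prodinf f" "prodinf f \<le> 1"
    using LIMSEQ_le_const[OF l] LIMSEQ_le_const2[OF l] by blast+
  moreover have "prodinf f \<noteq> 0"
    using convergent_prod_to_zero_iff[OF c] l f(1) by (metis less_irrefl)
  ultimately show "0 < prodinf f" "prodinf f \<le> 1" by auto
qed

text \<open>The Weierstrass inequality bounds the deficit of the inner product by a geometric tail.
  These bounds are summable in r, so the outer product is positive for the same reason as the inner
  ones.\<close>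

lemma Pl_constant_pos:
  fixes t :: real
  assumes t: "0 < t" "t < 1"
  shows "(\<Prod>r. \<Prod>j. 1 - t ^ (r + 1 + j)) > 0"
proof -
  have geo: "summable (\<lambda>j. t ^ (k + j))" "(\<Sum>j\<le>n. t ^ (k + j)) \<le> t ^ k / (1 - t)" for k n
  proof -
    have s: "(\<lambda>j. t ^ (k + j)) sums (t ^ k * (1 / (1 - t)))"
      unfolding power_add by (intro sums_mult geometric_sums) (use t in simp)
    then show "summable (\<lambda>j. t ^ (k + j))" by (rule sums_summable)
    have "(\<Sum>j\<in>{..n}. t ^ (k + j)) \<le> suminf (\<lambda>j. t ^ (k + j))"
      using t by (intro sum_le_suminf sums_summable[OF s]) auto
    with s show "(\<Sum>j\<le>n. t ^ (k + j)) \<le> t ^ k / (1 - t)"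
      by (simp add: sums_iff)
  qed
  have f: "0 < 1 - t ^ (r + 1 + j)" "1 - t ^ (r + 1 + j) \<le> 1" for r j
    using t power_less_one_iff[of t "r + 1 + j"] by auto
  define c where "c r = (\<Prod>j. 1 - t ^ (r + 1 + j))" for r
  have "summable (\<lambda>j. 1 - (1 - t ^ (r + 1 + j)))" for r
    using geo(1)[of "r + 1"] by simp
  note c = prodinf_pos_unit[OF f this, folded c_def]
  have "1 - t ^ (r + 1) / (1 - t) \<le> c r" for r
  proof (rule LIMSEQ_le_const[OF c(3)], intro exI allI impI)
    fix n
    have "1 - (\<Sum>j\<le>n. t ^ (r + 1 + j)) \<le> (\<Prod>j\<le>n. 1 - t ^ (r + 1 + j))"
    proof (rule Weierstrass_prod_ineq)
      show "t ^ (r + 1 + j) \<in> {0..1}" for j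
        using t power_le_one[of t "r + 1 + j"] by simp
    qed
    then show "1 - t ^ (r + 1) / (1 - t) \<le> (\<Prod>j\<le>n. 1 - t ^ (r + 1 + j))"
      using geo(2)[of "r + 1" n] by linarith
  qed
  then have "norm (1 - c r) \<le> t ^ (1 + r) / (1 - t)" for r
    using c(2)[of r] by (simp add: algebra_simps)
  moreover have "summable (\<lambda>r. t ^ (1 + r) / (1 - t))"
    by (intro summable_divide geo)
  ultimately have "summable (\<lambda>r. 1 - c r)"
    by (rule summable_comparison_test'[rotated])
  from prodinf_pos_unit(1)[OF c(1,2) this] show ?thesis
    by (simp add: c_def)
qed

subsection \<open>The procedure\<close>

lemma pmf_embed_pmf_finite:
  assumes A: "finite A" "\<And>x. x \<notin> A \<Longrightarrow> f x = 0" and nn: "\<And>x. f x \<ge> 0" and 1: "sum f A = 1"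
  shows "pmf (embed_pmf f) x = f x"
proof (rule pmf_embed_pmf[OF nn])
  have "(\<integral>\<^sup>+ x. ennreal (f x) \<partial>count_space UNIV) = (\<Sum>x\<in>A. ennreal (f x))"
    by (rule nn_integral_count_space') (use A in auto)
  also have "\<dots> = 1"
    using nn 1 by simp
  finally show "(\<integral>\<^sup>+ x. ennreal (f x) \<partial>count_space UNIV) = 1" .
qed

lemma pmf_bind_finite:
  assumes "finite A" "\<And>x. x \<notin> A \<Longrightarrow> pmf p x = 0"
  shows "pmf (bind_pmf p f) y = (\<Sum>x\<in>A. pmf p x * pmf (f x) y)"
  unfolding pmf_bind
  by (subst integral_measure_pmf_real[of A]) (use assms in \<open>auto simp: set_pmf_iff mult.commute\<close>)

lemma schur_eq_hook_prod:
  "schur (1 / q) l = 1 / (q ^ n_stat l * hook_prod q l)"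
  by (simp add: schur_def hook_prod_def power_one_over)

lemma growth_prob_eq:
  "growth_prob q l a L = (if interlace l L \<and> psize L = psize l + a
     then qpoch (1 / q) a * schur (1 / q) L / schur (1 / q) l else 0)"
proof -
  have "horizontal_strip l L \<and> card (diagram L - diagram l) = a \<longleftrightarrow>
      interlace l L \<and> psize L = psize l + a"
  proof (cases "interlace l L")
    case True
    then have "diagram l \<subseteq> diagram L"
      by (simp add: diagram_subset_iff interlaceD)
    with True show ?thesis
      using interlace_psize_le[OF True] by (auto simp: horizontal_strip_iff_interlace card_strip)
  qed (simp add: horizontal_strip_iff_interlace)
  then show ?thesis
    unfolding growth_prob_def schur_eq_hook_prod
    by (simp add: qpoch_def power_one_over)
qed

section \<open>Point masses, recursion and termination of the procedure\<close>

context
  fixes q t :: real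
  assumes q: "q > 1" and t_def: "t = 1 / q"
begin

lemma t_unit: "0 < t" "t < 1"
  using q by (simp_all add: t_def)

lemma pmf_size_pmf:
  assumes "m > 0"
  shows "pmf (size_pmf q m) a = size_prob q m a"
  unfolding size_pmf_def
proof (rule pmf_embed_pmf_finite[of "{..m}"])
  show "size_prob q m a \<ge> 0" for a
    unfolding size_prob_eq[OF q] t_def[symmetric]
    using t_unit seq_sum_pos[OF t_unit] qpoch_pos[OF t_unit] by (simp add: less_imp_le)
  have "sum (size_prob q m) {..m} = (\<Sum>a\<le>m. t ^ m / qpoch t a * seq_sum t (m - a)) / seq_sum t m"
    unfolding sum_divide_distrib by (intro sum.cong refl) (simp add: size_prob_eq[OF q] t_def)
  also have "\<dots> = 1"
    using seq_sum_pos[OF t_unit, of m] by (simp only: seq_sum_rec[OF t_unit, symmetric]) simp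
  finally show "sum (size_prob q m) {..m} = 1" .
qed (auto simp: size_prob_def)

lemma pmf_growth_pmf: "pmf (growth_pmf q l a) L = growth_prob q l a L"
  unfolding growth_pmf_def
proof (rule pmf_embed_pmf_finite[of "{L. interlace l L \<and> psize L = psize l + a}"])
  show "growth_prob q l a L \<ge> 0" for L
    unfolding growth_prob_eq t_def[symmetric]
    using schur_pos[OF t_unit] qpoch_pos[OF t_unit] by (simp add: less_imp_le)
  have "sum (growth_prob q l a) {L. interlace l L \<and> psize L = psize l + a}
      = (\<Sum>L | interlace l L \<and> psize L = psize l + a. schur t L) * (qpoch t a / schur t l)"
    unfolding sum_distrib_right by (intro sum.cong refl) (simp add: growth_prob_eq t_def)
  also have "\<dots> = 1"
    unfolding schur_pieri[OF t_unit] using schur_pos[OF t_unit, of l] qpoch_pos[OF t_unit, of a] by simp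
  finally show "sum (growth_prob q l a) {L. interlace l L \<and> psize L = psize l + a} = 1" .
qed (auto simp: growth_prob_eq finite_partitions_size_conj)

text \<open>With \<open>x\<close> of type \<open>partition option\<close>, one recursion covers the
  outputs \<open>Some L\<close> and the event \<open>None\<close> of never stopping.\<close>

definition scaled_run :: "nat \<Rightarrow> partition \<Rightarrow> partition option \<Rightarrow> real" where
  "scaled_run m l x = seq_sum t m * schur t l * pmf (run q m l) x"

lemma run_0 [simp]: "run q 0 l = return_spmf l"
  by (subst run.simps) simp

text \<open>The quotients of \<open>seq_sum\<close> and of \<open>schur\<close> in the transition
  probabilities are absorbed by the scaling and the factors \<open>qpoch t a\<close> cancel. As
  \<open>psize l + m\<close> is invariant, the next partition determines the remaining m. The term L
  = l is the step a = 0.\<close>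

lemma scaled_run_rec:
  assumes m: "m > 0"
  shows "scaled_run m l x =
    t ^ m * (\<Sum>L | interlace l L \<and> psize L \<le> psize l + m. scaled_run (psize l + m - psize L) L x)"
proof -
  let ?U = "\<lambda>a. {L. interlace l L \<and> psize L = psize l + a}"
  let ?V = "{L. interlace l L \<and> psize L \<le> psize l + m}"
  have finV: "finite ?V"
    by (rule finite_subset[OF _ finite_partitions_size_le[of "psize l + m"]]) auto
  have "pmf (run q m l) x = (\<Sum>a\<le>m. size_prob q m a *
      (\<Sum>L\<in>?U a. growth_prob q l a L * pmf (run q (m - a) L) x))"
  proof -
    have "pmf (run q m l) x = pmf (bind_pmf (size_pmf q m) (\<lambda>a.
             bind_pmf (growth_pmf q l a) (\<lambda>L. run q (m - a) L))) x"
      using m by (subst run.simps) simp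
    also have "\<dots> = (\<Sum>a\<le>m. pmf (size_pmf q m) a * pmf (bind_pmf (growth_pmf q l a) (\<lambda>L. run q (m - a) L)) x)"
      by (rule pmf_bind_finite) (simp_all add: pmf_size_pmf[OF m] size_prob_def)
    also have "\<dots> = (\<Sum>a\<le>m. size_prob q m a * (\<Sum>L\<in>?U a. growth_prob q l a L * pmf (run q (m - a) L) x))"
    proof (intro sum.cong refl)
      fix a
      have "pmf (bind_pmf (growth_pmf q l a) (\<lambda>L. run q (m - a) L)) x
          = (\<Sum>L\<in>?U a. pmf (growth_pmf q l a) L * pmf (run q (m - a) L) x)"
        by (rule pmf_bind_finite)
           (auto simp: pmf_growth_pmf growth_prob_eq finite_partitions_size_conj)
      then show "pmf (size_pmf q m) a * pmf (bind_pmf (growth_pmf q l a) (\<lambda>L. run q (m - a) L)) x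
          = size_prob q m a * (\<Sum>L\<in>?U a. growth_prob q l a L * pmf (run q (m - a) L) x)"
        by (simp add: pmf_growth_pmf pmf_size_pmf[OF m])
    qed
    finally show ?thesis .
  qed
  also have "\<dots> = (\<Sum>a\<le>m. \<Sum>L\<in>?U a. t ^ m * scaled_run (m - a) L x / (seq_sum t m * schur t l))"
    unfolding sum_distrib_left
  proof (intro sum.cong refl)
    fix a L assume "a \<in> {..m}" "L \<in> ?U a"
    then show "size_prob q m a * (growth_prob q l a L * pmf (run q (m - a) L) x)
        = t ^ m * scaled_run (m - a) L x / (seq_sum t m * schur t l)"
      using qpoch_pos[OF t_unit, of a]
      by (simp add: size_prob_eq[OF q] growth_prob_eq t_def[symmetric] scaled_run_def)
  qed
  finally have "scaled_run m l x = (\<Sum>a\<le>m. \<Sum>L\<in>?U a. t ^ m * scaled_run (m - a) L x)"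
    using seq_sum_pos[OF t_unit, of m] schur_pos[OF t_unit, of l]
    by (simp add: scaled_run_def[of m] sum_divide_distrib[symmetric])
  also have "\<dots> = (\<Sum>a\<le>m. \<Sum>L | L \<in> ?V \<and> psize L - psize l = a. t ^ m * scaled_run (psize l + m - psize L) L x)"
  proof (intro sum.cong refl)
    fix a assume a: "a \<in> {..m}"
    then show "?U a = {L. L \<in> ?V \<and> psize L - psize l = a}"
      by (auto dest: interlace_psize_le)
    fix L assume "L \<in> {L. L \<in> ?V \<and> psize L - psize l = a}"
    then have "psize l + m - psize L = m - a"
      using interlace_psize_le[of l L] by auto
    then show "t ^ m * scaled_run (m - a) L x = t ^ m * scaled_run (psize l + m - psize L) L x"
      by simp
  qed
  also have "\<dots> = (\<Sum>L\<in>?V. t ^ m * scaled_run (psize l + m - psize L) L x)"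
    by (rule sum.group[OF finV]) auto
  finally show ?thesis by (simp add: sum_distrib_left)
qed

text \<open>By invariance of \<open>psize l + m\<close> all terms but L = l vanish inductively, so
  the mass equals t^m times itself. For \<open>x = None\<close> the hypothesis is vacuous, and this
  is termination with probability one.\<close>

lemma run_unreachable:
  assumes "\<And>L. x = Some L \<Longrightarrow> psize L \<noteq> psize l + m"
  shows "pmf (run q m l) x = 0"
  using assms
proof (induction m arbitrary: l rule: less_induct)
  case (less m)
  show ?case
  proof (cases "m = 0")
    case True
    then show ?thesis using less.prems by (cases x) (auto split: split_indicator)
  next
    case False
    let ?V = "{L. interlace l L \<and> psize L \<le> psize l + m}"
    have "finite ?V"
      by (rule finite_subset[OF _ finite_partitions_size_le[of "psize l + m"]]) auto
    then have "(\<Sum>L\<in>?V. scaled_run (psize l + m - psize L) L x)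
        = scaled_run m l x + (\<Sum>L\<in>?V - {l}. scaled_run (psize l + m - psize L) L x)"
      by (subst sum.remove[of _ l]) auto
    also have "(\<Sum>L\<in>?V - {l}. scaled_run (psize l + m - psize L) L x) = 0"
    proof (rule sum.neutral, rule ballI)
      fix L assume L: "L \<in> ?V - {l}"
      then have "psize l < psize L"
        using interlace_psize_le[of l L] interlace_psize_eq[of l L] by (auto simp: le_less)
      then have "pmf (run q (psize l + m - psize L) L) x = 0"
        using L less.prems by (intro less.IH) auto
      then show "scaled_run (psize l + m - psize L) L x = 0"
        by (simp add: scaled_run_def)
    qed
    finally have "(1 - t ^ m) * scaled_run m l x = 0"
      using scaled_run_rec[of m l x] False by (simp add: algebra_simps)
    moreover have "t ^ m < 1" using t_unit False by (simp add: power_less_one_iff)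
    ultimately show ?thesis
      using seq_sum_pos[OF t_unit, of m] schur_pos[OF t_unit, of l] by (simp add: scaled_run_def)
  qed
qed

lemma spmf_procedure_output:
  assumes "psize L = n"
  shows "spmf (procedure_output q n) L = t ^ n * (schur t L)\<^sup>2 / seq_sum t n"
proof -
  \<comment> \<open>Only m = psize L - psize l can lead from \<open>l\<close> to \<open>L\<close>;
    dividing by \<open>schur t L\<close> makes the diagonal 1 and later supplies the second Schur
    factor.\<close>
  define g where "g l L = (if psize l \<le> psize L
     then scaled_run (psize L - psize l) l (Some L) / schur t L else 0)" for l L
  have nz: "schur t l \<noteq> 0" for l using schur_pos[OF t_unit, of l] by simp
  interpret skew_kernel t g
  proof
    show "g l l = 1" for l
      using nz by (simp add: g_def scaled_run_def seq_sum_0[OF t_unit])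
    show "g l L = 0" if "psize L \<le> psize l" "l \<noteq> L" for l L
      using that by (auto simp: g_def scaled_run_def)
    show "g l L = t ^ (psize L - psize l) * (\<Sum>m | interlace l m \<and> psize m \<le> psize L. g m L)"
      if le: "psize l \<le> psize L" for l L
    proof (cases "psize l = psize L")
      case True
      then have "{m. interlace l m \<and> psize m \<le> psize L} = {l}"
        using interlace_psize_le interlace_psize_eq by fastforce
      then show ?thesis using True by simp
    next
      case False
      with le have "g l L = t ^ (psize L - psize l) *
          (\<Sum>m | interlace l m \<and> psize m \<le> psize L. scaled_run (psize L - psize m) m (Some L) / schur t L)"
        by (simp add: g_def scaled_run_rec sum_divide_distrib[symmetric])
      also have "(\<Sum>m | interlace l m \<and> psize m \<le> psize L. scaled_run (psize L - psize m) m (Some L) / schur t L)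
          = (\<Sum>m | interlace l m \<and> psize m \<le> psize L. g m L)"
        by (intro sum.cong) (auto simp: g_def)
      finally show ?thesis .
    qed
  qed (use t_unit in auto)
  have "schur t empty_partition = 1"
    by (simp add: schur_def n_stat_def diagram_def)
  then have "seq_sum t n * spmf (procedure_output q n) L = t ^ n * schur t L * schur t L"
    using kernel_from_empty[of L] assms nz[of L]
    by (simp add: g_def scaled_run_def procedure_output_def divide_simps)
  then show ?thesis
    using seq_sum_pos[OF t_unit, of n] by (simp add: power2_eq_square field_simps)
qed

section \<open>Comparison with the conditioned measure\<close>

lemma emeasure_procedure_output:
  "emeasure (measure_spmf (procedure_output q n)) B
 = (\<Sum>L | psize L = n \<and> L \<in> B. ennreal (t ^ n * (schur t L)\<^sup>2 / seq_sum t n))"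
proof -
  let ?p = "procedure_output q n"
  have 0: "spmf ?p L = 0" if "psize L \<noteq> n" for L
    unfolding procedure_output_def using that by (intro run_unreachable) simp
  have "emeasure (measure_spmf ?p) B = (\<integral>\<^sup>+ x. ennreal (spmf ?p x) * indicator B x \<partial>count_space UNIV)"
    by (subst nn_integral_measure_spmf[symmetric]) simp
  also have "\<dots> = (\<Sum>L | psize L = n \<and> L \<in> B. ennreal (spmf ?p L) * indicator B L)"
    by (rule nn_integral_count_space')
       (use 0 finite_subset[OF _ finite_partitions_size[of n]] in \<open>auto simp: indicator_def\<close>)
  also have "\<dots> = (\<Sum>L | psize L = n \<and> L \<in> B. ennreal (t ^ n * (schur t L)\<^sup>2 / seq_sum t n))"
    by (intro sum.cong) (auto simp: spmf_procedure_output)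
  finally show ?thesis .
qed

lemma lossless_procedure_output: "lossless_spmf (procedure_output q n)"
  unfolding lossless_iff_pmf_None procedure_output_def by (rule run_unreachable) simp

text \<open>The size-n part of a Cauchy identity, obtained here because the output distribution,
  already known pointwise, has total mass 1.\<close>

lemma schur_square_sum: "(\<Sum>L | psize L = n. t ^ n * (schur t L)\<^sup>2) = seq_sum t n"
proof -
  have nn: "t ^ n * (schur t L)\<^sup>2 / seq_sum t n \<ge> 0" for L
    using t_unit seq_sum_pos[OF t_unit, of n] by simp
  have "ennreal 1 = emeasure (measure_spmf (procedure_output q n)) UNIV"
    using lossless_procedure_output[of n]
    by (simp add: measure_spmf.emeasure_eq_measure lossless_spmf_def weight_spmf_def)
  also have "\<dots> = ennreal (\<Sum>L | psize L = n. t ^ n * (schur t L)\<^sup>2 / seq_sum t n)"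
    unfolding emeasure_procedure_output using nn by simp
  finally have "(\<Sum>L | psize L = n. t ^ n * (schur t L)\<^sup>2 / seq_sum t n) = 1"
    using nn by (subst (asm) ennreal_inj) (auto intro: sum_nonneg)
  then show ?thesis
    using seq_sum_pos[OF t_unit, of n] by (simp add: sum_divide_distrib[symmetric])
qed

lemma Pl_weight_eq:
  obtains C where "C > 0" "\<And>l. Pl_weight q l = C * (t ^ psize l * (schur t l)\<^sup>2)"
proof
  show "(\<Prod>r. \<Prod>j. 1 - t ^ (r + 1 + j)) > 0"
    by (rule Pl_constant_pos[OF t_unit])
  show "Pl_weight q l = (\<Prod>r. \<Prod>j. 1 - t ^ (r + 1 + j)) * (t ^ psize l * (schur t l)\<^sup>2)" for l
    unfolding Pl_weight_def schur_def t_def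
    by (simp add: power_one_over power_divide prod_power_distrib power_mult_distrib power_add power_mult[symmetric] mult.commute)
qed

lemma measure_spmf_procedure_output:
  "measure_spmf (procedure_output q n) = uniform_measure (M_Pl q) {l. psize l = n}"
proof (rule measure_eqI)
  show sets: "sets (measure_spmf (procedure_output q n)) = sets (uniform_measure (M_Pl q) {l. psize l = n})"
    by (simp add: M_Pl_def sets_point_measure)
  fix B assume "B \<in> sets (measure_spmf (procedure_output q n))"
  obtain C where C: "C > 0" "\<And>l. Pl_weight q l = C * (t ^ psize l * (schur t l)\<^sup>2)"
    using Pl_weight_eq by blast
  let ?w = "\<lambda>l. t ^ n * (schur t l)\<^sup>2"
  let ?A = "{l. psize l = n}"
  have P: "seq_sum t n > 0" by (rule seq_sum_pos[OF t_unit])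
  have M: "emeasure (M_Pl q) S = ennreal (C * (\<Sum>l\<in>S. ?w l))" if "S \<subseteq> ?A" for S
  proof -
    have "finite S" using that finite_partitions_size finite_subset by blast
    then have "emeasure (M_Pl q) S = (\<Sum>l\<in>S. ennreal (Pl_weight q l))"
      unfolding M_Pl_def by (intro emeasure_point_measure_finite2) auto
    also have "\<dots> = (\<Sum>l\<in>S. ennreal (C * ?w l))"
      using that by (intro sum.cong) (auto simp: C(2))
    also have "\<dots> = ennreal (\<Sum>l\<in>S. C * ?w l)"
      using C t_unit by (intro sum_ennreal) simp
    finally show ?thesis by (simp add: sum_distrib_left)
  qed
  have "emeasure (uniform_measure (M_Pl q) ?A) B = emeasure (M_Pl q) (?A \<inter> B) / emeasure (M_Pl q) ?A"
    by (rule emeasure_uniform_measure) (auto simp: M_Pl_def sets_point_measure)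
  also have "\<dots> = ennreal (C * (\<Sum>l\<in>?A \<inter> B. ?w l)) / ennreal (C * seq_sum t n)"
    by (simp add: M schur_square_sum)
  \<comment> \<open>Here the infinite product \<open>C\<close> cancels; its positivity keeps the
    denominator nonzero.\<close>
  also have "\<dots> = ennreal ((\<Sum>l\<in>?A \<inter> B. ?w l) / seq_sum t n)"
    using C P t_unit by (subst divide_ennreal) (auto intro!: sum_nonneg mult_nonneg_nonneg)
  also have "\<dots> = (\<Sum>L | psize L = n \<and> L \<in> B. ennreal (?w L / seq_sum t n))"
    using P t_unit by (subst sum_ennreal) (auto simp: sum_divide_distrib Int_def)
  finally show "emeasure (measure_spmf (procedure_output q n)) B = emeasure (uniform_measure (M_Pl q) ?A) B"
    by (simp add: emeasure_procedure_output)
qed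

end

theorem theorem9:
  fixes q :: real and n :: nat
  assumes "q > 1"
  shows "(\<forall>m>0. \<forall>a. pmf (size_pmf q m) a = size_prob q m a)
       \<and> (\<forall>l a L. pmf (growth_pmf q l a) L = growth_prob q l a L)
       \<and> lossless_spmf (procedure_output q n)
       \<and> measure_spmf (procedure_output q n) = uniform_measure (M_Pl q) {l. psize l = n}"
  using pmf_size_pmf[OF assms refl] pmf_growth_pmf[OF assms refl]
    lossless_procedure_output[OF assms refl] measure_spmf_procedure_output[OF assms refl]
  by simp

end
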